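(* Let $\Omega$ be an open subset of $\mathbb{C}$ with $\Omega=\operatorname{int}\overline{\Omega}$ and for which $\overline{\Omega}$ satisfies the strong regularity condition. Then the following are equivalent. (i) The subspace $\{p|_{\Omega}:p\in\mathbb{C}[z]\}$ of $A^\infty(\Omega)$ is dense in $A^\infty(\Omega)$. (ii) $\mathbb{C}\setminus\overline{\Omega}$ does not have a bounded connected component.
   Context: $A^\infty(\Omega)$ is the space of holomorphic functions $g$ on $\Omega$ all of whose derivatives $g^{(l)}$, $l\in\mathbb{N}_0$, extend continuously to $\overline{\Omega}$. It is a Fréchet space with the seminorms $\|g\|_{m,K}=\max_{0\le l\le m,\,z\in K}|g^{(l)}(z)|$, $m\in\mathbb{N}_0$, $K\subset\overline{\Omega}$ compact (where $g^{(l)}$ also denotes the continuous extension). A path connected closed set $F\subset\mathbb{R}^d$ (here $\mathbb{R}^2\cong\mathbb{C}$) with $F=\overline{\operatorname{int}F}$ satisfies the strong regularity condition if for all $x_0\in F$ there are $\epsilon>0$, $C>0$ and $\theta\in(0,1]$ such that any two points $x,y\in F\cap B(x_0,\epsilon)$ (open Euclidean ball) can be joined by a rectifiable arc $\gamma\subset F$ with length $|\gamma|$ such that (1) $\gamma$ meets the boundary of $F$ at most finitely many times, and (2) $|\gamma|\le C|x-y|^\theta$. *)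

theory Defs
  imports "HOL-Analysis.Analysis" "HOL-Computational_Algebra.Polynomial"
begin

definition inscribed_lengths :: "(real \<Rightarrow> 'a::metric_space) \<Rightarrow> real set" where
  "inscribed_lengths g =
     {(\<Sum>i<n. dist (g (t i)) (g (t (Suc i)))) | (t :: nat \<Rightarrow> real) n.
        mono_on {..n} t \<and> t 0 = 0 \<and> t n = 1}"

definition rectifiable :: "(real \<Rightarrow> 'a::metric_space) \<Rightarrow> bool" where
  "rectifiable g \<longleftrightarrow> path g \<and> bdd_above (inscribed_lengths g)"

definition arc_length :: "(real \<Rightarrow> 'a::metric_space) \<Rightarrow> real" where
  "arc_length g = Sup (inscribed_lengths g)"

(* The case x = y is trivial (the joining curve is a single point) and is left out because
   the library's arcs are injective on {0..1}, hence have distinct end points.  By the same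
   injectivity, finitely many meeting points is the same as finitely many meeting times. *)
definition strongly_regular :: "'a::euclidean_space set \<Rightarrow> bool" where
  "strongly_regular F \<longleftrightarrow>
     path_connected F \<and> closed F \<and> F = closure (interior F) \<and>
     (\<forall>x0\<in>F. \<exists>\<epsilon>>0. \<exists>C>0. \<exists>\<theta>. 0 < \<theta> \<and> \<theta> \<le> 1 \<and>
        (\<forall>x \<in> F \<inter> ball x0 \<epsilon>. \<forall>y \<in> F \<inter> ball x0 \<epsilon>. x \<noteq> y \<longrightarrow>
           (\<exists>\<gamma>. arc \<gamma> \<and> rectifiable \<gamma> \<and> pathstart \<gamma> = x \<and> pathfinish \<gamma> = y \<and>
                path_image \<gamma> \<subseteq> F \<and>
                finite (path_image \<gamma> \<inter> frontier F) \<and>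
                arc_length \<gamma> \<le> C * dist x y powr \<theta>)))"

definition is_continuous_extension ::
  "'a::topological_space set \<Rightarrow> ('a \<Rightarrow> 'b::topological_space) \<Rightarrow> ('a \<Rightarrow> 'b) \<Rightarrow> bool" where
  "is_continuous_extension S f h \<longleftrightarrow> continuous_on (closure S) h \<and> (\<forall>z\<in>S. h z = f z)"

(* For Hausdorff codomains the values on closure S do not depend on the choice. *)
definition continuous_extension ::
  "'a::topological_space set \<Rightarrow> ('a \<Rightarrow> 'b::topological_space) \<Rightarrow> 'a \<Rightarrow> 'b" where
  "continuous_extension S f = (SOME h. is_continuous_extension S f h)"

(* Functions on \<Omega> are represented by extensional total functions, so that equality of
   elements is equality on \<Omega>. *)
definition A_infinity :: "complex set \<Rightarrow> (complex \<Rightarrow> complex) set" where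
  "A_infinity \<Omega> =
     {g \<in> extensional \<Omega>. g holomorphic_on \<Omega> \<and>
        (\<forall>l. \<exists>h. is_continuous_extension \<Omega> ((deriv ^^ l) g) h)}"

(* The inserted 0 changes nothing for nonempty K and gives the value 0 for empty K. *)
definition A_infinity_seminorm ::
  "complex set \<Rightarrow> nat \<Rightarrow> complex set \<Rightarrow> (complex \<Rightarrow> complex) \<Rightarrow> real" where
  "A_infinity_seminorm \<Omega> m K g =
     Sup (insert 0 {cmod (continuous_extension \<Omega> ((deriv ^^ l) g) z) | l z. l \<le> m \<and> z \<in> K})"

definition A_infinity_topology :: "complex set \<Rightarrow> (complex \<Rightarrow> complex) topology" where
  "A_infinity_topology \<Omega> = topology_generated_by
     {{h \<in> A_infinity \<Omega>. A_infinity_seminorm \<Omega> m K (\<lambda>z. h z - g z) < \<epsilon>} | g m K \<epsilon>.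
        g \<in> A_infinity \<Omega> \<and> compact K \<and> K \<subseteq> closure \<Omega> \<and> 0 < \<epsilon>}"

lemma topspace_A_infinity_topology: "topspace (A_infinity_topology \<Omega>) = A_infinity \<Omega>"
proof (rule antisym)
  show "topspace (A_infinity_topology \<Omega>) \<subseteq> A_infinity \<Omega>"
    unfolding A_infinity_topology_def topology_generated_by_topspace by blast
  show "A_infinity \<Omega> \<subseteq> topspace (A_infinity_topology \<Omega>)"
  proof
    fix h assume h: "h \<in> A_infinity \<Omega>"
    let ?B = "{f \<in> A_infinity \<Omega>. A_infinity_seminorm \<Omega> 0 {} (\<lambda>z. f z - h z) < 1}"
    have "openin (A_infinity_topology \<Omega>) ?B"
      unfolding A_infinity_topology_def
    proof (rule topology_generated_by_Basis, rule CollectI, intro exI conjI)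
      show "?B = ?B" ..
    qed (use h in simp_all)
    moreover have "h \<in> ?B"
      using h by (simp add: A_infinity_seminorm_def)
    ultimately show "h \<in> topspace (A_infinity_topology \<Omega>)"
      using openin_subset by blast
  qed
qed

end

theory Submission
  imports Defs "HOL-Complex_Analysis.Complex_Analysis"
begin

text \<open>If the complement of \<open>F = closure \<Omega>\<close> has a bounded component containing \<open>a\<close>, then
  \<open>1 / (z - a)\<close> cannot be approximated uniformly on the frontier of that component, by the maximum
  principle.

  Conversely, let \<open>g\<close> lie in \<open>A_infinity \<Omega>\<close> and let \<open>T x\<close> be its Taylor polynomial of high
  order at a point \<open>x\<close> of \<open>F\<close>. Integrating \<open>g\<close> and its derivatives along the arcs given by
  strong regularity shows that \<open>T x\<close> and \<open>T y\<close> differ by at most a high power of \<open>s\<close> on discs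
  of radius \<open>s\<close> when \<open>dist x y \<le> s\<close>. Cover a compact piece \<open>L\<close> of \<open>F\<close> by a square grid of width \<open>d\<close>,
  choose a Taylor polynomial for every square near \<open>L\<close>, and take the Cauchy integral of these
  polynomials over the outer edges of the union of the squares. This function is holomorphic near \<open>L\<close>;
  since there are only \<open>O(1 / d\<^sup>2)\<close> edges, each with a tiny jump, it is close to \<open>T x\<close> on a disc
  of radius comparable with \<open>d\<close> around each \<open>x\<close> in \<open>L\<close>, so by Cauchy's estimates its derivatives at \<open>x\<close> are close to
  those of \<open>g\<close>. Finally \<open>- L\<close> is connected, and Runge's pole shifting replaces
  the Cauchy kernels by polynomials on a neighbourhood of \<open>L\<close>.\<close>

section \<open>Taylor expansion along rectifiable arcs\<close>

text \<open>\<open>V t\<close> is the supremum of the inscribed sums over partitions of the time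
  interval from 0 to \<open>t\<close>. Appending the node \<open>b\<close> to a partition that ends
  at \<open>a\<close> adds \<open>dist (g a) (g b)\<close> to its sum.\<close>

lemma rectifiable_variation:
  fixes g :: "real \<Rightarrow> 'a::metric_space"
  assumes "rectifiable g"
  obtains V where "0 \<le> V 0" "V 1 = arc_length g"
    "\<And>a b. 0 \<le> a \<Longrightarrow> a \<le> b \<Longrightarrow> b \<le> 1 \<Longrightarrow> dist (g a) (g b) \<le> V b - (V a :: real)"
proof -
  define I where "I t = {(\<Sum>i<n. dist (g (s i)) (g (s (Suc i)))) | (s :: nat \<Rightarrow> real) n.
        mono_on {..n} s \<and> s 0 = 0 \<and> s n = t}" for t
  have I1: "I 1 = inscribed_lengths g"
    by (simp add: I_def inscribed_lengths_def)
  have ext: "x + dist (g a) (g b) \<in> I b" if x: "x \<in> I a" and "a \<le> b" for x a b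
  proof -
    obtain s n where s: "x = (\<Sum>i<n. dist (g (s i)) (g (s (Suc i))))"
      "mono_on {..n} s" "s 0 = 0" "s n = a"
      using x by (auto simp: I_def)
    let ?s = "s(Suc n := b)"
    have "x + dist (g a) (g b) = (\<Sum>i<Suc n. dist (g (?s i)) (g (?s (Suc i))))"
      using s by simp
    moreover have "mono_on {..Suc n} ?s"
    proof (rule mono_onI)
      fix i j assume "i \<in> {..Suc n}" "j \<in> {..Suc n}" "i \<le> j"
      moreover have "s i \<le> b" if "i \<le> n" for i
        using mono_onD[OF s(2), of i n] s(4) \<open>a \<le> b\<close> that by auto
      ultimately show "?s i \<le> ?s j"
        using mono_onD[OF s(2), of i j] by (auto simp: le_Suc_eq)
    qed
    ultimately show ?thesis
      unfolding I_def using s(3) by (intro CollectI exI[of _ ?s] exI[of _ "Suc n"]) auto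
  qed
  \<comment> \<open>Appending the node 1 turns a sum up to \<open>t\<close> into a full inscribed
    sum, so one bound serves every \<open>t\<close>.\<close>
  have bdd: "bdd_above (I t)" if "t \<le> 1" for t
  proof -
    obtain M where M: "\<And>x. x \<in> I 1 \<Longrightarrow> x \<le> M"
      using assms unfolding rectifiable_def I1[symmetric] bdd_above_def by auto
    have "x \<le> M" if "x \<in> I t" for x
      using M[OF ext[OF that \<open>t \<le> 1\<close>]] zero_le_dist[of "g t" "g 1"] by linarith
    then show ?thesis by (auto simp: bdd_above_def)
  qed
  have zero: "0 \<in> I 0"
    unfolding I_def by (intro CollectI exI[of _ "\<lambda>_. 0"] exI[of _ 0]) (auto simp: mono_on_def)
  have ne: "I a \<noteq> {}" if "0 \<le> a" for a
    using ext[OF zero that] by auto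
  show ?thesis
  proof
    show "0 \<le> Sup (I 0)"
      using zero bdd[of 0] by (intro cSup_upper) auto
    show "Sup (I 1) = arc_length g"
      by (simp add: I1 arc_length_def)
    fix a b :: real assume ab: "0 \<le> a" "a \<le> b" "b \<le> 1"
    have "Sup (I a) \<le> Sup (I b) - dist (g a) (g b)"
    proof (rule cSup_least[OF ne[OF ab(1)]])
      fix x assume "x \<in> I a"
      then have "x + dist (g a) (g b) \<le> Sup (I b)"
        using ext ab bdd[of b] by (intro cSup_upper) auto
      then show "x \<le> Sup (I b) - dist (g a) (g b)" by linarith
    qed
    then show "dist (g a) (g b) \<le> Sup (I b) - Sup (I a)" by linarith
  qed
qed

text \<open>The variation function \<open>V\<close> need not be continuous: across an exceptional time only
  the continuity of \<open>f \<circ> g\<close> and the monotonicity of \<open>V\<close> are used.\<close>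

lemma increment_bound_along_path:
  fixes g :: "real \<Rightarrow> complex" and f f' :: "complex \<Rightarrow> complex"
  assumes "path g"
    and V: "\<And>a b. 0 \<le> a \<Longrightarrow> a \<le> b \<Longrightarrow> b \<le> 1 \<Longrightarrow> dist (g a) (g b) \<le> V b - (V a :: real)"
    and "open S" and fin: "finite {t\<in>{0..1}. g t \<notin> S}"
    and contf: "continuous_on (path_image g) f"
    and f': "\<And>z. z \<in> S \<Longrightarrow> (f has_field_derivative f' z) (at z)"
    and contf': "continuous_on S f'"
    and B: "\<And>t. t \<in> {0..1} \<Longrightarrow> g t \<in> S \<Longrightarrow> norm (f' (g t)) \<le> B" and "0 \<le> B"
    and ab: "0 \<le> a" "a \<le> b" "b \<le> 1"
  shows "norm (f (g b) - f (g a)) \<le> B * (V b - V a)"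
proof -
  have Vmono: "V s \<le> V t" if "0 \<le> s" "s \<le> t" "t \<le> 1" for s t
    using V[OF that] zero_le_dist[of "g s" "g t"] by linarith
  have gcont: "continuous_on {0..1} g"
    using \<open>path g\<close> by (simp add: path_def)
  have fgcont: "continuous_on {0..1} (\<lambda>t. f (g t))"
    using contf gcont by (intro continuous_on_compose2[OF contf gcont]) (auto simp: path_image_def)
  \<comment> \<open>The slack \<open>e\<close> pays for the oscillation of \<open>f'\<close> near a
    point of the path and is removed at the end.\<close>
  have main: "norm (f (g b) - f (g a)) \<le> (B + e) * (V b - V a)" if "e > 0" for e
  proof -
    define P where "P u v \<longleftrightarrow> norm (f (g v) - f (g u)) \<le> (B + e) * (V v - V u)" for u v
    have trans: "P u w" if "P u v" "P v w" for u v w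
    proof -
      have "norm (f (g w) - f (g u)) \<le> norm (f (g w) - f (g v)) + norm (f (g v) - f (g u))"
        by norm
      also have "\<dots> \<le> (B + e) * (V w - V v) + (B + e) * (V v - V u)"
        using that unfolding P_def by linarith
      finally show ?thesis unfolding P_def by (simp add: algebra_simps)
    qed
    \<comment> \<open>While the path stays in \<open>S\<close>, bisection reduces to short
      intervals. The image of such an interval lies in a ball inside \<open>S\<close> where
      \<open>norm (f' z) \<le> B + e\<close>, and the mean value inequality applies to the
      chord.\<close>
    have good: "P u v" if uv: "0 \<le> u" "u \<le> v" "v \<le> 1" and gS: "\<And>t. u \<le> t \<Longrightarrow> t \<le> v \<Longrightarrow> g t \<in> S" for u v
    proof -
      have "u \<le> u \<and> v \<le> v \<longrightarrow> P u v"
        using \<open>u \<le> v\<close>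
      proof (induction rule: Bolzano[where P = "\<lambda>s t. u \<le> s \<and> t \<le> v \<longrightarrow> P s t"])
        case (trans r s t)
        then show ?case using \<open>\<And>w v u. \<lbrakk>P u v; P v w\<rbrakk> \<Longrightarrow> P u w\<close>[of r s t] by auto
      next
        case (local x)
        have gx: "g x \<in> S" using gS local by auto
        have "isCont f' (g x)"
          using contf' \<open>open S\<close> gx by (simp add: continuous_on_eq_continuous_at)
        then obtain r0 where r0: "r0 > 0" "\<And>z. dist z (g x) < r0 \<Longrightarrow> dist (f' z) (f' (g x)) < e"
          using \<open>e > 0\<close> unfolding continuous_at_eps_delta by blast
        obtain r1 where r1: "r1 > 0" "ball (g x) r1 \<subseteq> S"
          using \<open>open S\<close> gx open_contains_ball by blast
        define r where "r = min r0 r1"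
        have r: "r > 0" "ball (g x) r \<subseteq> S" using r0 r1 by (auto simp: r_def)
        have f'r: "norm (f' z) \<le> B + e" if "z \<in> ball (g x) r" for z
        proof -
          have "dist (f' z) (f' (g x)) < e"
            using that by (intro r0) (auto simp: r_def dist_commute)
          moreover have "norm (f' (g x)) \<le> B"
            using gx local uv by (intro B) auto
          moreover have "norm (f' z) \<le> norm (f' (g x)) + dist (f' z) (f' (g x))"
            unfolding dist_norm by norm
          ultimately show ?thesis by linarith
        qed
        obtain d where d: "d > 0" "\<And>t. t \<in> {0..1} \<Longrightarrow> dist t x < d \<Longrightarrow> dist (g t) (g x) < r"
          using gcont \<open>r > 0\<close> local uv unfolding continuous_on_iff by force
        have "P s t" if st: "s \<le> x" "x \<le> t" "t - s < d" "u \<le> s" "t \<le> v" for s t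
        proof -
          have s: "g s \<in> ball (g x) r" and t: "g t \<in> ball (g x) r"
            using d(2)[of s] d(2)[of t] st uv by (auto simp: dist_commute dist_real_def)
          have "norm (f (g t) - f (g s)) \<le> (B + e) * norm (g t - g s)"
          proof (rule field_differentiable_bound[OF convex_ball _ f'r t s])
            fix z assume "z \<in> ball (g x) r"
            then show "(f has_field_derivative f' z) (at z within ball (g x) r)"
              using f' r(2) has_field_derivative_at_within by blast
          qed
          also have "\<dots> \<le> (B + e) * (V t - V s)"
            using V[of s t] st uv \<open>0 \<le> B\<close> \<open>e > 0\<close>
            by (intro mult_left_mono) (auto simp: dist_norm norm_minus_commute)
          finally show ?thesis unfolding P_def .
        qed
        then show ?case using d(1) by blast
      qed
      then show ?thesis by simp
    qed
    have Be: "0 \<le> B + e" using \<open>0 \<le> B\<close> \<open>e > 0\<close> by simp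
    \<comment> \<open>A second bisection handles the exceptional times: a short interval around
      \<open>x\<close> contains none except possibly \<open>x\<close> itself, so it is split at
      \<open>x\<close>, and each half is a limit of good intervals.\<close>
    have "a \<le> a \<and> b \<le> b \<longrightarrow> P a b"
      using \<open>a \<le> b\<close>
    proof (induction rule: Bolzano[where P = "\<lambda>s t. a \<le> s \<and> t \<le> b \<longrightarrow> P s t"])
      case (trans r s t)
      then show ?case using \<open>\<And>w v u. \<lbrakk>P u v; P v w\<rbrakk> \<Longrightarrow> P u w\<close>[of r s t] by auto
    next
      case (local x)
      obtain d where d: "d > 0" "\<And>t. t \<in> {t\<in>{0..1}. g t \<notin> S} \<Longrightarrow> t \<noteq> x \<Longrightarrow> d \<le> dist x t"
        using finite_set_avoid[OF fin] by blast
      have "P s t" if st: "s \<le> x" "x \<le> t" "t - s < d" "a \<le> s" "t \<le> b" for s t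
      proof -
        have gS: "g r \<in> S" if "s \<le> r" "r \<le> t" "r \<noteq> x" for r
        proof (rule ccontr)
          assume "g r \<notin> S"
          then have "d \<le> dist x r" using that st ab by (intro d(2)) auto
          then show False using that st by (simp add: dist_real_def)
        qed
        have "P s x"
        proof (cases "s = x")
          case False
          then have "s < x" using st by simp
          have "norm (f (g x) - f (g s)) \<le> (B + e) * (V x - V s)"
          proof (rule continuous_le_on_closure[of "{s..<x}" "\<lambda>r. norm (f (g r) - f (g s))"])
            show "continuous_on (closure {s..<x}) (\<lambda>r. norm (f (g r) - f (g s)))"
              using \<open>s < x\<close> st ab
              by (intro continuous_intros continuous_on_subset[OF fgcont]) auto
            show "x \<in> closure {s..<x}" using \<open>s < x\<close> by simp
            fix r assume r: "r \<in> {s..<x}"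
            then have "P s r" using gS st ab by (intro good) auto
            then have "norm (f (g r) - f (g s)) \<le> (B + e) * (V r - V s)" by (simp add: P_def)
            also have "\<dots> \<le> (B + e) * (V x - V s)"
              using Be Vmono[of r x] r st ab by (intro mult_left_mono) auto
            finally show "norm (f (g r) - f (g s)) \<le> (B + e) * (V x - V s)" .
          qed
          then show ?thesis by (simp add: P_def)
        qed (simp add: P_def)
        moreover have "P x t"
        proof (cases "x = t")
          case False
          then have "x < t" using st by simp
          have "norm (f (g t) - f (g x)) \<le> (B + e) * (V t - V x)"
          proof (rule continuous_le_on_closure[of "{x<..t}" "\<lambda>r. norm (f (g t) - f (g r))"])
            show "continuous_on (closure {x<..t}) (\<lambda>r. norm (f (g t) - f (g r)))"
              using \<open>x < t\<close> st ab
              by (intro continuous_intros continuous_on_subset[OF fgcont]) auto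
            show "x \<in> closure {x<..t}" using \<open>x < t\<close> by simp
            fix r assume r: "r \<in> {x<..t}"
            then have "P r t" using gS st ab by (intro good) auto
            then have "norm (f (g t) - f (g r)) \<le> (B + e) * (V t - V r)" by (simp add: P_def)
            also have "\<dots> \<le> (B + e) * (V t - V x)"
              using Be Vmono[of x r] r st ab by (intro mult_left_mono) auto
            finally show "norm (f (g t) - f (g r)) \<le> (B + e) * (V t - V x)" .
          qed
          then show ?thesis by (simp add: P_def)
        qed (simp add: P_def)
        ultimately show ?thesis using trans by blast
      qed
      then show ?case using d(1) by blast
    qed
    then show ?thesis by (simp add: P_def)
  qed
  show ?thesis
  proof (rule field_le_epsilon)
    fix e :: real assume "e > 0"
    let ?D = "V b - V a"
    have D: "?D \<ge> 0" using Vmono[OF ab] by simp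
    \<comment> \<open>The \<open>+ 1\<close> covers the case \<open>?D = 0\<close>; the excess is at
      most \<open>e\<close>.\<close>
    have "norm (f (g b) - f (g a)) \<le> (B + e / (?D + 1)) * ?D"
      using D \<open>e > 0\<close> by (intro main) (auto intro!: divide_pos_pos)
    also have "\<dots> = B * ?D + e * (?D / (?D + 1))"
      by (simp add: algebra_simps)
    also have "\<dots> \<le> B * ?D + e"
      using D \<open>e > 0\<close> mult_left_le[of "?D / (?D + 1)" e] by (simp add: divide_le_eq)
    finally show "norm (f (g b) - f (g a)) \<le> B * ?D + e" .
  qed
qed

section \<open>Taylor polynomials of a jet\<close>

text \<open>\<open>G\<close> is a jet: \<open>G l\<close> stands for the \<open>l\<close>-th
  derivative. The sum is the Taylor polynomial of \<open>G l\<close> at \<open>x\<close>;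
  \<open>n\<close> counts its terms, so a differentiation raises \<open>l\<close> and lowers
  \<open>n\<close> by one.\<close>

definition taylor_sum :: "(nat \<Rightarrow> complex \<Rightarrow> complex) \<Rightarrow> complex \<Rightarrow> nat \<Rightarrow> nat \<Rightarrow> complex \<Rightarrow> complex"
  where "taylor_sum G x l n z = (\<Sum>k<n. G (l + k) x / fact k * (z - x) ^ k)"

lemma taylor_sum_0 [simp]: "taylor_sum G x l 0 z = 0"
  by (simp add: taylor_sum_def)

lemma taylor_sum_center [simp]: "taylor_sum G x l (Suc n) x = G l x"
  unfolding taylor_sum_def sum.lessThan_Suc_shift by simp

lemma has_field_derivative_taylor_sum:
  "(taylor_sum G x l (Suc n) has_field_derivative taylor_sum G x (Suc l) n z) (at z)"
proof -
  have "((\<lambda>z. G l x + (\<Sum>k<n. G (l + Suc k) x / fact (Suc k) * (z - x) ^ Suc k))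
    has_field_derivative (\<Sum>k<n. G (l + Suc k) x / fact (Suc k) * (of_nat (Suc k) * (z - x) ^ k))) (at z)"
    by (auto intro!: derivative_eq_intros sum.cong simp del: power_Suc fact_Suc of_nat_Suc simp: mult_ac)
  moreover have "taylor_sum G x l (Suc n)
      = (\<lambda>z. G l x + (\<Sum>k<n. G (l + Suc k) x / fact (Suc k) * (z - x) ^ Suc k))"
    unfolding taylor_sum_def sum.lessThan_Suc_shift by (simp add: fun_eq_iff)
  moreover have "taylor_sum G x (Suc l) n z
      = (\<Sum>k<n. G (l + Suc k) x / fact (Suc k) * (of_nat (Suc k) * (z - x) ^ k))"
    unfolding taylor_sum_def
    by (intro sum.cong refl) (simp add: field_simps del: of_nat_Suc)
  ultimately show ?thesis by simp
qed

lemma higher_deriv_taylor_sum: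
  "(deriv ^^ l) (taylor_sum G x j (n + l)) = taylor_sum G x (j + l) n"
proof (induction l arbitrary: n)
  case (Suc l)
  have "(deriv ^^ Suc l) (taylor_sum G x j (n + Suc l)) = deriv (taylor_sum G x (j + l) (Suc n))"
    using Suc[of "Suc n"] by simp
  also have "\<dots> = taylor_sum G x (j + Suc l) n"
    using DERIV_imp_deriv[OF has_field_derivative_taylor_sum] by (simp add: fun_eq_iff)
  finally show ?case .
qed simp

lemma holomorphic_on_taylor_sum: "taylor_sum G x l n holomorphic_on S"
  unfolding taylor_sum_def by (intro holomorphic_intros)

text \<open>The polynomial about \<open>x\<close> is expanded anew about \<open>y\<close>, where its
  \<open>l\<close>-th derivative is \<open>taylor_sum G x l (n - l) y\<close>. Regrouping by
  \<open>m = l + k\<close> reduces this to the binomial theorem for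
  \<open>(z - y) + (y - x)\<close>.\<close>

lemma taylor_sum_recentre:
  "taylor_sum G x 0 n z = (\<Sum>l<n. taylor_sum G x l (n - l) y / fact l * (z - y) ^ l)"
proof -
  have "(\<Sum>l<n. taylor_sum G x l (n - l) y / fact l * (z - y) ^ l)
      = (\<Sum>l<n. \<Sum>k<n-l. G (l + k) x * ((y - x) ^ k / fact k * ((z - y) ^ l / fact l)))"
    by (intro sum.cong refl) (simp add: taylor_sum_def sum_distrib_left sum_distrib_right sum_divide_distrib mult_ac)
  also have "\<dots> = (\<Sum>(l,k)\<in>{(l,k). l + k < n}. G (l + k) x * ((y - x) ^ k / fact k * ((z - y) ^ l / fact l)))"
    by (subst sum.Sigma) (auto intro!: sum.cong)
  also have "\<dots> = (\<Sum>m<n. \<Sum>l\<le>m. G m x * ((y - x) ^ (m - l) / fact (m - l) * ((z - y) ^ l / fact l)))"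
    by (subst sum.triangle_reindex) (auto intro!: sum.cong)
  also have "\<dots> = (\<Sum>m<n. G m x / fact m * (z - x) ^ m)"
  proof (intro sum.cong refl)
    fix m
    have "(z - x) ^ m = ((z - y) + (y - x)) ^ m" by simp
    also have "\<dots> = (\<Sum>l\<le>m. of_nat (m choose l) * (z - y) ^ l * (y - x) ^ (m - l))"
      by (rule binomial_ring)
    also have "\<dots> = (\<Sum>l\<le>m. fact m * ((y - x) ^ (m - l) / fact (m - l) * ((z - y) ^ l / fact l)))"
      by (intro sum.cong refl) (simp add: binomial_fact field_simps)
    finally show "(\<Sum>l\<le>m. G m x * ((y - x) ^ (m - l) / fact (m - l) * ((z - y) ^ l / fact l)))
        = G m x / fact m * (z - x) ^ m"
      by (simp add: sum_distrib_left)
  qed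
  finally show ?thesis by (simp add: taylor_sum_def)
qed

text \<open>Induction on \<open>n\<close>: the remainder with \<open>Suc n\<close> terms vanishes at
  \<open>g 0\<close>, and its derivative is the remainder for \<open>Suc l\<close> with
  \<open>n\<close> terms. Each integration along the arc costs one factor
  \<open>arc_length g\<close>.\<close>

lemma taylor_remainder_along_arc:
  assumes F: "closed F"
    and contG: "\<And>l. continuous_on F (G l)"
    and derG: "\<And>l z. z \<in> interior F \<Longrightarrow> (G l has_field_derivative G (Suc l) z) (at z)"
    and g: "arc g" "rectifiable g" "path_image g \<subseteq> F" "finite (path_image g \<inter> frontier F)"
    and B: "\<And>t. t \<in> {0..1} \<Longrightarrow> norm (G (l + n) (g t)) \<le> B"
    and t: "t \<in> {0..1}"
  shows "norm (G l (g t) - taylor_sum G (g 0) l n (g t)) \<le> B * arc_length g ^ n"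
proof -
  obtain V where V: "0 \<le> V 0" "V 1 = arc_length g"
    "\<And>a b. 0 \<le> a \<Longrightarrow> a \<le> b \<Longrightarrow> b \<le> 1 \<Longrightarrow> dist (g a) (g b) \<le> V b - (V a :: real)"
    using rectifiable_variation[OF g(2)] by metis
  \<comment> \<open>Injectivity turns finitely many frontier points into finitely many exceptional
    times.\<close>
  have "inj_on g {0..1}" using g(1) by (simp add: arc_def)
  moreover have "g ` {t\<in>{0..1}. g t \<notin> interior F} \<subseteq> path_image g \<inter> frontier F"
    using g(3) F by (auto simp: frontier_def path_image_def)
  ultimately have fin: "finite {t\<in>{0..1}. g t \<notin> interior F}"
    using finite_subset[OF _ g(4)] by (intro finite_imageD[of g]) (auto intro: inj_on_subset)
  have pathg: "path g" using g(1) by (simp add: arc_imp_path)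
  have L: "V t - V 0 \<le> arc_length g" "0 \<le> arc_length g" if "t \<in> {0..1}" for t
  proof -
    have "V t \<le> V 1" "V 0 \<le> V 1"
      using V(3)[of t 1] V(3)[of 0 1] that zero_le_dist[of "g t" "g 1"] zero_le_dist[of "g 0" "g 1"]
      by (auto simp del: zero_le_dist)
    then show "V t - V 0 \<le> arc_length g" "0 \<le> arc_length g"
      using V(1,2) by linarith+
  qed
  show ?thesis using B t
  proof (induction n arbitrary: l t)
    case (Suc n)
    have IH: "norm (G (Suc l) (g t) - taylor_sum G (g 0) (Suc l) n (g t)) \<le> B * arc_length g ^ n"
      if "t \<in> {0..1}" for t
      using Suc.prems(1) that by (intro Suc.IH) auto
    let ?f = "\<lambda>l n z. G l z - taylor_sum G (g 0) l n z"
    have "0 \<le> B" using order_trans[OF norm_ge_zero Suc.prems(1)[of 0]] by simp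
    have holo: "(?f l (Suc n) has_field_derivative ?f (Suc l) n z) (at z)" if "z \<in> interior F" for z
      by (rule DERIV_diff[OF derG[OF that] has_field_derivative_taylor_sum])
    have "norm (?f l (Suc n) (g t) - ?f l (Suc n) (g 0)) \<le> B * arc_length g ^ n * (V t - V 0)"
    proof (rule increment_bound_along_path[OF pathg V(3) open_interior fin, where f' = "?f (Suc l) n"])
      show "continuous_on (path_image g) (?f l (Suc n))"
        by (intro continuous_intros continuous_on_subset[OF contG g(3)]
            holomorphic_on_imp_continuous_on holomorphic_on_taylor_sum)
      show "continuous_on (interior F) (?f (Suc l) n)"
        by (intro continuous_intros continuous_on_subset[OF contG interior_subset]
            holomorphic_on_imp_continuous_on holomorphic_on_taylor_sum)
    qed (use holo IH \<open>0 \<le> B\<close> L Suc.prems(2) in auto)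
    also have "\<dots> \<le> B * arc_length g ^ n * arc_length g"
      using L \<open>0 \<le> B\<close> Suc.prems(2) by (intro mult_left_mono) auto
    finally show ?case by (simp add: mult_ac)
  qed auto
qed

lemma rectifiable_dist_le_arc_length:
  assumes "rectifiable g" "t \<in> {0..1}"
  shows "dist (g 0) (g t) \<le> arc_length g"
proof -
  obtain V where V: "0 \<le> V 0" "V 1 = arc_length g"
    "\<And>a b. 0 \<le> a \<Longrightarrow> a \<le> b \<Longrightarrow> b \<le> 1 \<Longrightarrow> dist (g a) (g b) \<le> V b - (V a :: real)"
    using rectifiable_variation[OF assms(1)] by metis
  show ?thesis
    using V(1,2) V(3)[of 0 t] V(3)[of t 1] assms(2) zero_le_dist[of "g t" "g 1"] by (auto simp del: zero_le_dist)
qed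

section \<open>Uniform regularity on compact sets and compatibility of Taylor polynomials\<close>

text \<open>Finitely many balls of half the admissible radius cover \<open>L\<close>, and a point
  closer than \<open>\<epsilon>\<close> to a point of a half ball lies in the full ball. The largest
  constant and the smallest exponent serve for all of them, because lowering the exponent raises
  powers of distances below 1.\<close>

lemma strongly_regular_uniform:
  fixes F :: "'a::euclidean_space set"
  assumes "strongly_regular F" "compact L" "L \<subseteq> F"
  obtains \<epsilon> C \<theta> :: real where "0 < \<epsilon>" "\<epsilon> \<le> 1" "0 < C" "0 < \<theta>" "\<theta> \<le> 1"
    "\<And>x y. x \<in> L \<Longrightarrow> y \<in> L \<Longrightarrow> x \<noteq> y \<Longrightarrow> dist x y < \<epsilon> \<Longrightarrow>
       \<exists>\<gamma>. arc \<gamma> \<and> rectifiable \<gamma> \<and> pathstart \<gamma> = x \<and> pathfinish \<gamma> = y \<and> path_image \<gamma> \<subseteq> F \<and>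
           finite (path_image \<gamma> \<inter> frontier F) \<and> arc_length \<gamma> \<le> C * dist x y powr \<theta>"
proof -
  define Q where "Q x y l \<longleftrightarrow> (\<exists>\<gamma>. arc \<gamma> \<and> rectifiable \<gamma> \<and> pathstart \<gamma> = x \<and> pathfinish \<gamma> = y \<and>
      path_image \<gamma> \<subseteq> F \<and> finite (path_image \<gamma> \<inter> frontier F) \<and> arc_length \<gamma> \<le> l)" for x y l
  have "\<forall>x0\<in>F. \<exists>\<epsilon>>0. \<exists>C>0. \<exists>\<theta>. 0 < \<theta> \<and> \<theta> \<le> 1 \<and>
      (\<forall>x \<in> F \<inter> ball x0 \<epsilon>. \<forall>y \<in> F \<inter> ball x0 \<epsilon>. x \<noteq> y \<longrightarrow> Q x y (C * dist x y powr \<theta>))"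
    using assms(1) unfolding strongly_regular_def Q_def by (elim conjE) assumption
  then have "\<forall>x0\<in>L. \<exists>\<epsilon> C \<theta>. \<epsilon> > 0 \<and> C > 0 \<and> 0 < \<theta> \<and> \<theta> \<le> 1 \<and>
      (\<forall>x \<in> F \<inter> ball x0 \<epsilon>. \<forall>y \<in> F \<inter> ball x0 \<epsilon>. x \<noteq> y \<longrightarrow> Q x y (C * dist x y powr \<theta>))"
    using \<open>L \<subseteq> F\<close> by (meson subsetD)
  then obtain e where "\<forall>x0\<in>L. \<exists>C \<theta>. e x0 > 0 \<and> C > 0 \<and> 0 < \<theta> \<and> \<theta> \<le> 1 \<and>
      (\<forall>x \<in> F \<inter> ball x0 (e x0). \<forall>y \<in> F \<inter> ball x0 (e x0). x \<noteq> y \<longrightarrow> Q x y (C * dist x y powr \<theta>))"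
    by (rule bchoice[THEN exE])
  then obtain c where "\<forall>x0\<in>L. \<exists>\<theta>. e x0 > 0 \<and> c x0 > 0 \<and> 0 < \<theta> \<and> \<theta> \<le> 1 \<and>
      (\<forall>x \<in> F \<inter> ball x0 (e x0). \<forall>y \<in> F \<inter> ball x0 (e x0). x \<noteq> y \<longrightarrow> Q x y (c x0 * dist x y powr \<theta>))"
    by (rule bchoice[THEN exE])
  then obtain t where "\<forall>x0\<in>L. e x0 > 0 \<and> c x0 > 0 \<and> 0 < t x0 \<and> t x0 \<le> 1 \<and>
      (\<forall>x \<in> F \<inter> ball x0 (e x0). \<forall>y \<in> F \<inter> ball x0 (e x0). x \<noteq> y \<longrightarrow> Q x y (c x0 * dist x y powr t x0))"
    by (rule bchoice[THEN exE])
  then have ect: "\<And>x0. x0 \<in> L \<Longrightarrow> e x0 > 0" "\<And>x0. x0 \<in> L \<Longrightarrow> c x0 > 0"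
    "\<And>x0. x0 \<in> L \<Longrightarrow> 0 < t x0" "\<And>x0. x0 \<in> L \<Longrightarrow> t x0 \<le> 1"
    "\<And>x0 x y. x0 \<in> L \<Longrightarrow> x \<in> F \<inter> ball x0 (e x0) \<Longrightarrow> y \<in> F \<inter> ball x0 (e x0) \<Longrightarrow> x \<noteq> y \<Longrightarrow>
        Q x y (c x0 * dist x y powr t x0)"
    by blast+
  obtain T where T: "T \<subseteq> L" "finite T" "L \<subseteq> (\<Union>x0\<in>T. ball x0 (e x0 / 2))"
  proof (rule compactE_image[OF \<open>compact L\<close>, of L "\<lambda>x0. ball x0 (e x0 / 2)"])
    show "L \<subseteq> (\<Union>x0\<in>L. ball x0 (e x0 / 2))" using ect(1) by force
  qed auto
  \<comment> \<open>The entry 1 gives \<open>\<epsilon> \<le> 1\<close>, \<open>1 \<le> C\<close>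
    and \<open>\<theta> \<le> 1\<close>, and keeps the sets nonempty when \<open>T\<close> is
    empty.\<close>
  define \<epsilon> where "\<epsilon> = Min (insert 1 ((\<lambda>x0. e x0 / 2) ` T))"
  define C where "C = Max (insert 1 (c ` T))"
  define \<theta> where "\<theta> = Min (insert 1 (t ` T))"
  have le: "\<epsilon> \<le> e x0 / 2" "c x0 \<le> C" "\<theta> \<le> t x0" if "x0 \<in> T" for x0
    unfolding \<epsilon>_def C_def \<theta>_def using T(2) that by (intro Min_le Max_ge; simp)+
  have pos: "0 < \<epsilon>" "0 < \<theta>"
    unfolding \<epsilon>_def \<theta>_def using T(1,2) ect(1,3) by (subst Min_gr_iff; auto)+
  have one: "\<epsilon> \<le> 1" "\<theta> \<le> 1" "1 \<le> C"
    unfolding \<epsilon>_def C_def \<theta>_def using T(2) by (auto intro!: Min_le Max_ge)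
  show ?thesis
  proof (rule that[OF pos(1) one(1) _ pos(2) one(2)])
    show "0 < C" using one(3) by simp
    fix x y assume xy: "x \<in> L" "y \<in> L" "x \<noteq> y" "dist x y < \<epsilon>"
    then obtain x0 where x0: "x0 \<in> T" "dist x0 x < e x0 / 2" using T(3) by auto
    have "dist x0 y \<le> dist x0 x + dist x y" by (rule dist_triangle)
    then have "dist x0 y < e x0" using le(1)[OF x0(1)] x0(2) xy(4) by linarith
    moreover have "dist x0 x < e x0" using x0(2) zero_le_dist[of x0 x] by linarith
    ultimately have "Q x y (c x0 * dist x y powr t x0)"
      using x0(1) xy T(1) \<open>L \<subseteq> F\<close> by (intro ect(5)) auto
    then obtain \<gamma> where \<gamma>: "arc \<gamma>" "rectifiable \<gamma>" "pathstart \<gamma> = x" "pathfinish \<gamma> = y" "path_image \<gamma> \<subseteq> F"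
      "finite (path_image \<gamma> \<inter> frontier F)" "arc_length \<gamma> \<le> c x0 * dist x y powr t x0"
      unfolding Q_def by blast
    have "c x0 * dist x y powr t x0 \<le> C * dist x y powr \<theta>"
      using le[OF x0(1)] xy(4) one(1,3) by (intro mult_mono powr_mono') auto
    then have "arc_length \<gamma> \<le> C * dist x y powr \<theta>" using \<gamma>(7) by linarith
    then show "\<exists>\<gamma>. arc \<gamma> \<and> rectifiable \<gamma> \<and> pathstart \<gamma> = x \<and> pathfinish \<gamma> = y \<and> path_image \<gamma> \<subseteq> F \<and>
        finite (path_image \<gamma> \<inter> frontier F) \<and> arc_length \<gamma> \<le> C * dist x y powr \<theta>"
      using \<gamma>(1-6) by blast
  qed
qed

text \<open>Both Taylor polynomials are expanded about \<open>x\<close>. The coefficient of order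
  \<open>l\<close> of their difference is a Taylor remainder of order \<open>N - l\<close> along an
  arc from \<open>y\<close> to \<open>x\<close>; together with \<open>(z - x) ^ l\<close> each
  summand is bounded by a constant times \<open>(s powr \<theta>) ^ N\<close>.\<close>

lemma taylor_sums_compatible:
  assumes F: "strongly_regular F"
    and contG: "\<And>l. continuous_on F (G l)"
    and derG: "\<And>l z. z \<in> interior F \<Longrightarrow> (G l has_field_derivative G (Suc l) z) (at z)"
  obtains N s0 A where "k \<le> N" "0 < s0" "0 \<le> A"
    "\<And>s x y z. 0 < s \<Longrightarrow> s \<le> s0 \<Longrightarrow> x \<in> F \<inter> cball 0 R \<Longrightarrow> y \<in> F \<inter> cball 0 R \<Longrightarrow>
       dist x y \<le> s \<Longrightarrow> dist z x \<le> s \<Longrightarrow>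
       norm (taylor_sum G x 0 N z - taylor_sum G y 0 N z) \<le> A * s ^ k"
proof -
  have "closed F" using F by (simp add: strongly_regular_def)
  have compF: "compact (F \<inter> cball 0 r)" for r
    using \<open>closed F\<close> by (simp add: closed_Int_compact)
  obtain \<epsilon> C \<theta> where \<epsilon>: "0 < \<epsilon>" "\<epsilon> \<le> 1" and C: "0 < C" and \<theta>: "0 < \<theta>" "\<theta> \<le> 1"
    and arcs: "\<And>x y. x \<in> F \<inter> cball 0 R \<Longrightarrow> y \<in> F \<inter> cball 0 R \<Longrightarrow> x \<noteq> y \<Longrightarrow> dist x y < \<epsilon> \<Longrightarrow>
       \<exists>\<gamma>. arc \<gamma> \<and> rectifiable \<gamma> \<and> pathstart \<gamma> = x \<and> pathfinish \<gamma> = y \<and> path_image \<gamma> \<subseteq> F \<and>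
           finite (path_image \<gamma> \<inter> frontier F) \<and> arc_length \<gamma> \<le> C * dist x y powr \<theta>"
    by (rule strongly_regular_uniform[OF F compF[of R]]) blast+
  \<comment> \<open>The order compensates the exponent of regularity:
    \<open>\<theta> * real N\<close> is at least \<open>k\<close>, which turns
    \<open>(s powr \<theta>) ^ N\<close> into \<open>s ^ k\<close>.\<close>
  define N where "N = nat \<lceil>real k / \<theta>\<rceil>"
  have "real k / \<theta> \<le> real N" unfolding N_def by linarith
  then have Nk: "real k \<le> \<theta> * real N" using \<theta>(1) by (simp add: pos_divide_le_eq mult.commute)
  also have "\<dots> \<le> 1 * real N" using \<theta>(2) by (intro mult_right_mono) auto
  finally have "k \<le> N" by simp
  \<comment> \<open>The arcs used below start in the disc of radius \<open>R\<close> and have length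
    at most \<open>C\<close>, so they stay in this larger disc.\<close>
  have "bounded (G N ` (F \<inter> cball 0 (R + C)))"
    using compF by (intro compact_imp_bounded compact_continuous_image continuous_on_subset[OF contG]) auto
  then obtain B where B: "0 < B" "\<And>z. z \<in> F \<inter> cball 0 (R + C) \<Longrightarrow> norm (G N z) \<le> B"
    by (auto simp: bounded_pos)
  define A where "A = real N * (B * (C + 1) ^ N)"
  show ?thesis
  proof (rule that[OF \<open>k \<le> N\<close>, of "\<epsilon> / 2" A])
    show "0 < \<epsilon> / 2" "0 \<le> A" using \<epsilon> B C by (auto simp: A_def)
    fix s x y z
    assume s: "0 < s" "s \<le> \<epsilon> / 2" and x: "x \<in> F \<inter> cball 0 R" and y: "y \<in> F \<inter> cball 0 R"
      and xy: "dist x y \<le> s" and zx: "dist z x \<le> s"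
    \<comment> \<open>\<open>u\<close> dominates both the arc length
      \<open>C * s powr \<theta>\<close> and \<open>s\<close>, so remainders of order
      \<open>N - l\<close> and powers \<open>(z - x) ^ l\<close> combine to
      \<open>u ^ N\<close>.\<close>
    define u where "u = (C + 1) * s powr \<theta>"
    have s1: "s < 1" "s < \<epsilon>" using s \<epsilon> by auto
    have su: "s \<le> u"
    proof -
      have "s powr 1 \<le> s powr \<theta>" using \<theta> s s1 by (intro powr_mono') auto
      also have "\<dots> \<le> u" unfolding u_def using C mult_right_mono[of 1 "C + 1" "s powr \<theta>"] by simp
      finally show ?thesis using s(1) by simp
    qed
    have rem: "norm (G l x - taylor_sum G y l (N - l) x) \<le> B * u ^ (N - l)" if "l < N" for l
    \<comment> \<open>No arc joins a point to itself; for \<open>x = y\<close> the remainder is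
      zero.\<close>
    proof (cases "x = y")
      case True
      obtain n where "N - l = Suc n" using \<open>l < N\<close> by (cases "N - l") auto
      with True have "taylor_sum G y l (N - l) x = G l x" by simp
      then show ?thesis using B(1) su s(1) by simp
    next
      case False
      then obtain \<gamma> where \<gamma>: "arc \<gamma>" "rectifiable \<gamma>" "pathstart \<gamma> = y" "pathfinish \<gamma> = x" "path_image \<gamma> \<subseteq> F"
        "finite (path_image \<gamma> \<inter> frontier F)" "arc_length \<gamma> \<le> C * dist y x powr \<theta>"
        using arcs[OF y x] xy s1 by (auto simp: dist_commute)
      have len: "arc_length \<gamma> \<le> C * s powr \<theta>"
      proof -
        have "C * dist y x powr \<theta> \<le> C * s powr \<theta>"
          using C xy \<theta> by (intro mult_left_mono powr_mono2) (auto simp: dist_commute)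
        then show ?thesis using \<gamma>(7) by linarith
      qed
      have "s powr \<theta> \<le> 1" using s1 s \<theta> by (intro powr_le1) auto
      then have lenC: "arc_length \<gamma> \<le> C" using len C mult_left_le[of "s powr \<theta>" C] by linarith
      have len0: "0 \<le> arc_length \<gamma>" using rectifiable_dist_le_arc_length[OF \<gamma>(2), of 0] by simp
      have "norm (G l (\<gamma> 1) - taylor_sum G (\<gamma> 0) l (N - l) (\<gamma> 1)) \<le> B * arc_length \<gamma> ^ (N - l)"
      proof (rule taylor_remainder_along_arc[where G = G, OF \<open>closed F\<close> contG derG \<gamma>(1,2,5,6)])
        fix t :: real assume t: "t \<in> {0..1}"
        have "\<gamma> t \<in> F" using \<gamma>(5) t by (auto simp: path_image_def)
        moreover have "norm (\<gamma> t) \<le> R + C"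
        proof -
          have "norm (\<gamma> t) \<le> norm (\<gamma> 0) + dist (\<gamma> 0) (\<gamma> t)" unfolding dist_norm by norm
          moreover have "norm (\<gamma> 0) \<le> R" using \<gamma>(3) y by (simp add: pathstart_def)
          ultimately show ?thesis
            using rectifiable_dist_le_arc_length[OF \<gamma>(2) t] lenC by linarith
        qed
        ultimately show "norm (G (l + (N - l)) (\<gamma> t)) \<le> B" using that by (intro B(2)[of "\<gamma> t", THEN back_subst[of "\<lambda>n. n \<le> B"]]) auto
      qed auto
      also have "\<dots> \<le> B * u ^ (N - l)"
      proof -
        have "C * s powr \<theta> \<le> u" unfolding u_def using C by (simp add: algebra_simps)
        then show ?thesis using len len0 B(1) by (intro mult_left_mono power_mono) auto
      qed
      finally show ?thesis using \<gamma>(3,4) by (simp add: pathstart_def pathfinish_def)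
    qed
    have summand: "norm ((G l x - taylor_sum G y l (N - l) x) / fact l * (z - x) ^ l) \<le> B * u ^ N" if "l < N" for l
    proof -
      have "norm ((G l x - taylor_sum G y l (N - l) x) / fact l * (z - x) ^ l)
          = norm (G l x - taylor_sum G y l (N - l) x) / fact l * norm (z - x) ^ l"
        by (simp add: norm_mult norm_divide norm_power)
      also have "\<dots> \<le> (B * u ^ (N - l)) / 1 * u ^ l"
        using rem[OF that] zx su s(1) B(1)
        by (intro mult_mono frac_le power_mono) (auto simp: dist_norm fact_ge_1)
      also have "\<dots> = B * u ^ N" using that by (simp flip: power_add)
      finally show ?thesis .
    qed
    have "taylor_sum G x 0 N z = (\<Sum>l<N. G l x / fact l * (z - x) ^ l)"
      by (simp add: taylor_sum_def)
    then have "taylor_sum G x 0 N z - taylor_sum G y 0 N z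
        = (\<Sum>l<N. (G l x - taylor_sum G y l (N - l) x) / fact l * (z - x) ^ l)"
      unfolding taylor_sum_recentre[of G y N z x]
      by (simp add: sum_subtractf diff_divide_distrib left_diff_distrib)
    then have "norm (taylor_sum G x 0 N z - taylor_sum G y 0 N z) \<le> (\<Sum>l<N. B * u ^ N)"
      using summand by (simp only:) (intro sum_norm_le, simp)
    also have "\<dots> = A * (s powr \<theta>) ^ N" by (simp add: A_def u_def power_mult_distrib)
    also have "(s powr \<theta>) ^ N = s powr (\<theta> * real N)"
      using s(1) by (simp add: powr_realpow[symmetric] powr_powr)
    also have "A * s powr (\<theta> * real N) \<le> A * s powr (real k)"
      using Nk s s1 \<open>0 \<le> A\<close> by (intro mult_left_mono powr_mono') auto
    also have "s powr (real k) = s ^ k" using s(1) by (rule powr_realpow)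
    finally show "norm (taylor_sum G x 0 N z - taylor_sum G y 0 N z) \<le> A * s ^ k" .
  qed
qed

section \<open>Uniform polynomial approximation of Cauchy integrals\<close>

text \<open>Membership in the uniform closure of the polynomials on \<open>N\<close>, which is an
  algebra when \<open>N\<close> is compact.\<close>

definition poly_approx :: "complex set \<Rightarrow> (complex \<Rightarrow> complex) \<Rightarrow> bool" where
  "poly_approx N f \<longleftrightarrow> (\<forall>e>0. \<exists>p. \<forall>z\<in>N. norm (f z - poly p z) \<le> e)"

lemma poly_approxI:
  assumes "\<And>e. e > 0 \<Longrightarrow> \<exists>g. poly_approx N g \<and> (\<forall>z\<in>N. norm (f z - g z) \<le> e)"
  shows "poly_approx N f"
  unfolding poly_approx_def
proof (intro allI impI)
  fix e :: real assume "e > 0"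
  then obtain g where g: "poly_approx N g" "\<And>z. z \<in> N \<Longrightarrow> norm (f z - g z) \<le> e / 2"
    using assms[of "e / 2"] by auto
  obtain p where p: "\<And>z. z \<in> N \<Longrightarrow> norm (g z - poly p z) \<le> e / 2"
    using g(1) \<open>e > 0\<close> unfolding poly_approx_def by (meson half_gt_zero)
  have "norm (f z - poly p z) \<le> e" if "z \<in> N" for z
  proof -
    have "norm (f z - poly p z) \<le> norm (f z - g z) + norm (g z - poly p z)" by norm
    then show ?thesis using g(2)[OF that] p[OF that] by linarith
  qed
  then show "\<exists>p. \<forall>z\<in>N. norm (f z - poly p z) \<le> e" by blast
qed

lemma poly_approx_cong: "(\<And>z. z \<in> N \<Longrightarrow> f z = g z) \<Longrightarrow> poly_approx N f \<longleftrightarrow> poly_approx N g"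
  by (simp add: poly_approx_def)

lemma poly_approx_subset: "poly_approx N f \<Longrightarrow> M \<subseteq> N \<Longrightarrow> poly_approx M f"
  unfolding poly_approx_def by blast

lemma poly_approx_poly: "poly_approx N (poly p)"
  unfolding poly_approx_def by (intro allI impI exI[of _ p]) auto

lemma poly_approx_const: "poly_approx N (\<lambda>_. c)"
  unfolding poly_approx_def by (intro allI impI exI[of _ "[:c:]"]) auto

lemma poly_approx_add:
  assumes "poly_approx N f" "poly_approx N g"
  shows "poly_approx N (\<lambda>z. f z + g z)"
  unfolding poly_approx_def
proof (intro allI impI)
  fix e :: real assume "e > 0"
  then obtain p q where p: "\<And>z. z \<in> N \<Longrightarrow> norm (f z - poly p z) \<le> e / 2"
    and q: "\<And>z. z \<in> N \<Longrightarrow> norm (g z - poly q z) \<le> e / 2"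
    using assms unfolding poly_approx_def by (meson half_gt_zero)
  have "norm (f z + g z - poly (p + q) z) \<le> e" if "z \<in> N" for z
  proof -
    have "norm (f z + g z - poly (p + q) z) \<le> norm (f z - poly p z) + norm (g z - poly q z)"
      unfolding poly_add by norm
    then show ?thesis using p[OF that] q[OF that] by linarith
  qed
  then show "\<exists>p. \<forall>z\<in>N. norm (f z + g z - poly p z) \<le> e" by blast
qed

lemma poly_approx_bounded:
  assumes "compact N" "poly_approx N f"
  obtains M where "M > 0" "\<And>z. z \<in> N \<Longrightarrow> norm (f z) \<le> M"
proof -
  obtain p where p: "\<And>z. z \<in> N \<Longrightarrow> norm (f z - poly p z) \<le> 1"
    using assms(2) unfolding poly_approx_def by (meson zero_less_one)
  have "bounded (poly p ` N)"
    using assms(1) by (intro compact_imp_bounded compact_continuous_image continuous_intros)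
  then obtain M where M: "M > 0" "\<And>z. z \<in> N \<Longrightarrow> norm (poly p z) \<le> M"
    by (auto simp: bounded_pos)
  have "norm (f z) \<le> M + 1" if "z \<in> N" for z
  proof -
    have "norm (f z) \<le> norm (poly p z) + norm (f z - poly p z)" by norm
    then show ?thesis using M(2)[OF that] p[OF that] by linarith
  qed
  then show ?thesis using M(1) that[of "M + 1"] by auto
qed

lemma poly_approx_mult:
  assumes "compact N" "poly_approx N f" "poly_approx N g"
  shows "poly_approx N (\<lambda>z. f z * g z)"
  unfolding poly_approx_def
proof (intro allI impI)
  fix e :: real assume "e > 0"
  obtain M where M: "M > 0" "\<And>z. z \<in> N \<Longrightarrow> norm (f z) \<le> M"
    using poly_approx_bounded[OF assms(1,2)] by metis
  have "e / (2 * M) > 0" using \<open>e > 0\<close> M by simp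
  then obtain q where q: "\<And>z. z \<in> N \<Longrightarrow> norm (g z - poly q z) \<le> e / (2 * M)"
    using assms(3) unfolding poly_approx_def by meson
  \<comment> \<open>\<open>q\<close> comes first because the tolerance for \<open>p\<close> depends
    on the bound \<open>K\<close> of \<open>q\<close>.\<close>
  obtain K where K: "K > 0" "\<And>z. z \<in> N \<Longrightarrow> norm (poly q z) \<le> K"
    using poly_approx_bounded[OF assms(1) poly_approx_poly] by metis
  have "e / (2 * K) > 0" using \<open>e > 0\<close> K by simp
  then obtain p where p: "\<And>z. z \<in> N \<Longrightarrow> norm (f z - poly p z) \<le> e / (2 * K)"
    using assms(2) unfolding poly_approx_def by meson
  have "norm (f z * g z - poly (p * q) z) \<le> e" if "z \<in> N" for z
  proof -
    have "f z * g z - poly (p * q) z = f z * (g z - poly q z) + (f z - poly p z) * poly q z"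
      by (simp add: algebra_simps)
    then have "norm (f z * g z - poly (p * q) z)
        \<le> norm (f z) * norm (g z - poly q z) + norm (f z - poly p z) * norm (poly q z)"
      by (metis norm_mult norm_triangle_ineq)
    also have "\<dots> \<le> M * (e / (2 * M)) + e / (2 * K) * K"
      using M K p q that \<open>e > 0\<close> by (intro add_mono mult_mono) auto
    also have "\<dots> = e" using M K by simp
    finally show ?thesis .
  qed
  then show "\<exists>p. \<forall>z\<in>N. norm (f z * g z - poly p z) \<le> e" by blast
qed

lemma poly_approx_power:
  assumes "compact N" "poly_approx N f"
  shows "poly_approx N (\<lambda>z. f z ^ n)"
  by (induction n) (auto intro: poly_approx_const poly_approx_mult[OF assms])

lemma poly_approx_sum:
  assumes "finite A" "\<And>i. i \<in> A \<Longrightarrow> poly_approx N (f i)"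
  shows "poly_approx N (\<lambda>z. \<Sum>i\<in>A. f i z)"
  using assms by (induction A) (auto intro: poly_approx_const poly_approx_add)

text \<open>Partial sums of the geometric series converge uniformly, since the remainder
  \<open>f z ^ n / (1 - f z)\<close> has modulus at most \<open>2 * (1 / 2) ^ n\<close>.\<close>

lemma poly_approx_geometric:
  assumes "compact N" "poly_approx N f" and half: "\<And>z. z \<in> N \<Longrightarrow> norm (f z) \<le> 1 / 2"
  shows "poly_approx N (\<lambda>z. 1 / (1 - f z))"
proof (rule poly_approxI)
  fix e :: real assume "e > 0"
  then obtain n where n: "(1 / 2 :: real) ^ n < e / 2"
    using real_arch_pow_inv[of "e / 2" "1 / 2"] by auto
  have "norm (1 / (1 - f z) - (\<Sum>k<n. f z ^ k)) \<le> e" if "z \<in> N" for z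
  proof -
    have "1 - norm (f z) \<le> norm (1 - f z)"
      using norm_triangle_ineq2[of 1 "f z"] by simp
    then have ge: "norm (1 - f z) \<ge> 1 / 2" using half[OF that] by linarith
    then have ne: "f z \<noteq> 1" by auto
    have "1 / (1 - f z) - (\<Sum>k<n. f z ^ k) = f z ^ n / (1 - f z)"
      using ne by (simp add: sum_gp_strict field_simps)
    then have "norm (1 / (1 - f z) - (\<Sum>k<n. f z ^ k)) = norm (f z) ^ n / norm (1 - f z)"
      by (simp add: norm_divide norm_power)
    also have "\<dots> \<le> (1 / 2) ^ n / (1 / 2)"
      using ge half[OF that] by (intro frac_le power_mono) auto
    also have "\<dots> \<le> e" using n by simp
    finally show ?thesis .
  qed
  moreover have "poly_approx N (\<lambda>z. \<Sum>k<n. f z ^ k)"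
    by (intro poly_approx_sum poly_approx_power assms) auto
  ultimately show "\<exists>g. poly_approx N g \<and> (\<forall>z\<in>N. norm (1 / (1 - f z) - g z) \<le> e)" by blast
qed

section \<open>Runge's pole shifting\<close>

text \<open>For the far pole \<open>v\<close> the kernel is a geometric series in
  \<open>z / v\<close>. From \<open>b\<close> to a nearby \<open>c\<close> the pole moves by
  \<open>1 / (c - z) = 1 / (b - z) * (1 / (1 - (b - c) / (b - z)))\<close>, again a geometric
  series, and connectedness of \<open>X\<close> carries it from \<open>v\<close> to
  \<open>a\<close>.\<close>

lemma poly_approx_cauchy_kernel:
  assumes "compact N" "compact X" "connected X" "X \<inter> N = {}"
    and "v \<in> X" "v \<noteq> 0" and v: "\<And>z. z \<in> N \<Longrightarrow> 2 * norm z \<le> norm v" and "a \<in> X"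
  shows "poly_approx N (\<lambda>z. 1 / (a - z))"
proof -
  \<comment> \<open>The distance between \<open>X\<close> and \<open>N\<close> sets the length of a
    shift: moves of at most \<open>d / 2\<close> keep the ratio at most 1/2.\<close>
  obtain d where d: "d > 0" "\<And>x z. x \<in> X \<Longrightarrow> z \<in> N \<Longrightarrow> d \<le> dist x z"
    using separate_compact_closed[OF \<open>compact X\<close> compact_imp_closed[OF \<open>compact N\<close>] \<open>X \<inter> N = {}\<close>] by blast
  have step: "poly_approx N (\<lambda>z. 1 / (c - z))"
    if b: "poly_approx N (\<lambda>z. 1 / (b - z))" "b \<in> X" "c \<in> X" "dist b c \<le> d / 2" for b c
  proof -
    have half: "norm ((b - c) * (1 / (b - z))) \<le> 1 / 2" if "z \<in> N" for z
    proof -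
      have "norm (b - c) \<le> norm (b - z) / 2"
        using d(2)[OF \<open>b \<in> X\<close> that] b(4) by (simp add: dist_norm)
      moreover have "norm (b - z) > 0" using d(2)[OF \<open>b \<in> X\<close> that] d(1) by (auto simp: dist_norm)
      ultimately show ?thesis by (simp only: norm_mult norm_divide norm_one) (simp add: divide_le_eq)
    qed
    have "poly_approx N (\<lambda>z. 1 / (b - z) * (1 / (1 - (b - c) * (1 / (b - z)))))"
      by (intro poly_approx_mult poly_approx_geometric \<open>compact N\<close> b poly_approx_const half)
    moreover have "1 / (b - z) * (1 / (1 - (b - c) * (1 / (b - z)))) = 1 / (c - z)" if "z \<in> N" for z
    proof -
      have "b \<noteq> z" "c \<noteq> z" using that b \<open>X \<inter> N = {}\<close> by auto
      then show ?thesis by (simp add: divide_simps)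
    qed
    ultimately show ?thesis using poly_approx_cong by (metis (no_types, lifting))
  qed
  have "poly_approx N (\<lambda>z. 1 / v * (1 / (1 - z / v)))"
  proof (intro poly_approx_mult poly_approx_geometric \<open>compact N\<close> poly_approx_const)
    show "poly_approx N (\<lambda>z. z / v)"
      unfolding poly_approx_def by (intro allI impI exI[of _ "[:0, 1 / v:]"]) auto
    show "norm (z / v) \<le> 1 / 2" if "z \<in> N" for z
      using v[OF that] \<open>v \<noteq> 0\<close> by (simp add: norm_divide divide_simps)
  qed
  moreover have "1 / v * (1 / (1 - z / v)) = 1 / (v - z)" if "z \<in> N" for z
  proof -
    have "v \<noteq> z" using that \<open>v \<in> X\<close> \<open>X \<inter> N = {}\<close> by auto
    then show ?thesis using \<open>v \<noteq> 0\<close> by (simp add: divide_simps)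
  qed
  ultimately have base: "poly_approx N (\<lambda>z. 1 / (v - z))"
    using poly_approx_cong by (metis (no_types, lifting))
  show ?thesis
  proof (rule connected_induction_simple[OF \<open>connected X\<close> \<open>v \<in> X\<close> \<open>a \<in> X\<close>,
        where P = "\<lambda>a. poly_approx N (\<lambda>z. 1 / (a - z))"])
    fix b assume "b \<in> X"
    have "dist x y \<le> d / 2" if "x \<in> ball b (d / 4)" "y \<in> ball b (d / 4)" for x y
      using that dist_triangle2[of x y b] by (simp add: dist_commute)
    then show "\<exists>T. openin (top_of_set X) T \<and> b \<in> T \<and>
        (\<forall>x\<in>T. \<forall>y\<in>T. poly_approx N (\<lambda>z. 1 / (x - z)) \<longrightarrow> poly_approx N (\<lambda>z. 1 / (y - z)))"
      using \<open>b \<in> X\<close> d(1) step by (intro exI[of _ "X \<inter> ball b (d / 4)"]) auto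
  qed (rule base)
qed

text \<open>One neighbourhood of \<open>L\<close> must serve all poles in a ball around
  \<open>w\<close>, to allow a compactness argument along a segment. \<open>X\<close> consists of a
  path in \<open>- L\<close> from \<open>w\<close> to a far point together with a disc around
  \<open>w\<close>.\<close>

lemma poly_approx_cauchy_kernel_near:
  fixes L :: "complex set"
  assumes "compact L" "connected (- L)" "w \<notin> L"
  obtains r where "r > 0" "\<And>c. c \<in> ball w r \<Longrightarrow> poly_approx (\<Union>x\<in>L. cball x r) (\<lambda>z. 1 / (c - z))"
proof -
  obtain M where M: "M > 0" "\<And>z. z \<in> L \<Longrightarrow> norm z \<le> M"
    using compact_imp_bounded[OF \<open>compact L\<close>] by (auto simp: bounded_pos)
  \<comment> \<open>\<open>norm v\<close> is twice \<open>M + 1\<close>, and \<open>M + 1\<close>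
    bounds the \<open>r\<close>-neighbourhood of \<open>L\<close> once
    \<open>r \<le> 1\<close>.\<close>
  define v :: complex where "v = of_real (2 * (M + 1))"
  have normv: "norm v = 2 * (M + 1)" using M(1) unfolding v_def norm_of_real by simp
  have "v \<notin> L" using M normv by force
  have "open (- L)" using \<open>compact L\<close> compact_imp_closed by blast
  then have "path_connected (- L)"
    using \<open>connected (- L)\<close> connected_open_path_connected by blast
  then obtain g where g: "path g" "path_image g \<subseteq> - L" "pathstart g = w" "pathfinish g = v"
    using \<open>w \<notin> L\<close> \<open>v \<notin> L\<close> unfolding path_connected_def by blast
  obtain s where s: "s > 0" "cball w s \<subseteq> - L"
    using \<open>open (- L)\<close> \<open>w \<notin> L\<close> open_contains_cball by (metis Compl_iff)
  define X where "X = path_image g \<union> cball w s"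
  have w: "w \<in> path_image g" and v: "v \<in> path_image g"
    using g pathstart_in_path_image pathfinish_in_path_image by metis+
  have X: "compact X" "connected X" "X \<inter> L = {}"
    unfolding X_def using g s w by (auto intro!: compact_Un connected_Un compact_path_image connected_path_image)
  obtain d where d: "d > 0" "\<And>x z. x \<in> X \<Longrightarrow> z \<in> L \<Longrightarrow> d \<le> dist x z"
    using separate_compact_closed[OF X(1) compact_imp_closed[OF \<open>compact L\<close>] X(3)] by blast
  \<comment> \<open>\<open>r \<le> s\<close> puts \<open>ball w r\<close> into \<open>X\<close>, and
    \<open>r < d\<close> keeps the neighbourhood of \<open>L\<close> off \<open>X\<close>.\<close>
  define r where "r = min (min s 1) (d / 2)"
  have r: "r > 0" "r \<le> s" "r \<le> 1" "r < d" using s d by (auto simp: r_def)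
  show ?thesis
  proof (rule that[OF r(1)])
    fix c assume c: "c \<in> ball w r"
    show "poly_approx (\<Union>x\<in>L. cball x r) (\<lambda>z. 1 / (c - z))"
    proof (rule poly_approx_cauchy_kernel[OF compact_minkowski_sum_cball[OF \<open>compact L\<close>] X(1,2)])
      show "X \<inter> (\<Union>x\<in>L. cball x r) = {}"
      proof safe
        fix x y assume "x \<in> X" "y \<in> L" "x \<in> cball y r"
        then show "x \<in> {}" using d(2)[of x y] r(4) by (simp add: dist_commute)
      qed
      show "v \<in> X" using v by (simp add: X_def)
      show "v \<noteq> 0" using normv M(1) by auto
      show "c \<in> X" using c r(2) by (simp add: X_def)
      fix z assume "z \<in> (\<Union>x\<in>L. cball x r)"
      then obtain x where x: "x \<in> L" "dist x z \<le> r" by auto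
      then have "norm z \<le> norm x + r" using norm_triangle_ineq2[of z x]
        by (simp add: dist_norm norm_minus_commute)
      then have "norm z \<le> M + 1" using M(2)[OF x(1)] r(3) by linarith
      then show "2 * norm z \<le> norm v" unfolding normv by simp
    qed
  qed
qed

text \<open>A Riemann sum: on a short piece \<open>f w / (w - z)\<close> is replaced by its value at
  one node \<open>c\<close>, uniformly in \<open>z\<close> by uniform continuity. This leaves a
  multiple of the kernel \<open>1 / (c - z)\<close>.\<close>

lemma poly_approx_cauchy_integral:
  assumes N: "compact N" "closed_segment a b \<inter> N = {}"
    and contf: "continuous_on (closed_segment a b) f"
    and approx: "\<And>c. c \<in> closed_segment a b \<Longrightarrow> poly_approx N (\<lambda>z. 1 / (c - z))"
  shows "poly_approx N (\<lambda>z. contour_integral (linepath a b) (\<lambda>w. f w / (w - z)))"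
proof (rule poly_approxI)
  fix e :: real assume "e > 0"
  define k where "k = (\<lambda>(w, z). f w / (w - z))"
  define I where "I s t z = contour_integral (linepath (linepath a b s) (linepath a b t)) (\<lambda>w. f w / (w - z))" for s t z
  have contk: "continuous_on (closed_segment a b \<times> N) k"
    unfolding k_def case_prod_beta using N(2)
    by (intro continuous_intros continuous_on_compose2[OF contf]) auto
  then have "uniformly_continuous_on (closed_segment a b \<times> N) k"
    using N(1) by (intro compact_uniformly_continuous compact_Times compact_segment)
  \<comment> \<open>The \<open>+ 1\<close> allows the degenerate segment
    \<open>a = b\<close>.\<close>
  define e' where "e' = e / (norm (b - a) + 1)"
  have "e' > 0" using \<open>e > 0\<close> by (auto simp: e'_def intro!: divide_pos_pos add_nonneg_pos)
  then obtain d where d: "d > 0" "\<And>p q. p \<in> closed_segment a b \<times> N \<Longrightarrow> q \<in> closed_segment a b \<times> N \<Longrightarrow>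
      dist q p < d \<Longrightarrow> dist (k q) (k p) < e'"
    using \<open>uniformly_continuous_on _ k\<close> unfolding uniformly_continuous_on_def by metis
  have cont: "continuous_on (closed_segment a b) (\<lambda>w. f w / (w - z))" if "z \<in> N" for z
    using N(2) that by (intro continuous_intros contf) auto
  have lin: "linepath a b t \<in> closed_segment a b" if "0 \<le> t" "t \<le> 1" for t
    using that by (auto simp: path_image_linepath[symmetric] path_image_def)
  have sub: "closed_segment (linepath a b s) (linepath a b t) \<subseteq> closed_segment a b"
    if "0 \<le> s" "s \<le> 1" "0 \<le> t" "t \<le> 1" for s t
    using lin that by (intro closed_segment_subset convex_closed_segment)
  have ldiff: "linepath a b t - linepath a b s = (t - s) *\<^sub>R (b - a)" for s t
    by (simp add: linepath_def algebra_simps)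
  \<comment> \<open>The allowed error is proportional to \<open>t - s\<close>, so the errors of
    adjacent pieces add up and bisection applies.\<close>
  define P where "P s t \<longleftrightarrow> (\<exists>g. poly_approx N g \<and> (\<forall>z\<in>N. norm (I s t z - g z) \<le> e * (t - s)))" for s t
  have "(0::real) \<le> 0 \<and> (1::real) \<le> 1 \<longrightarrow> P 0 1"
  proof (induction rule: Bolzano[where P = "\<lambda>s t. 0 \<le> s \<and> t \<le> 1 \<longrightarrow> P s t", OF zero_le_one, case_names trans local])
    case (trans r s t)
    show ?case
    proof (intro impI)
      assume rt: "0 \<le> r \<and> t \<le> 1"
      then obtain g h where g: "poly_approx N g" "\<And>z. z \<in> N \<Longrightarrow> norm (I r s z - g z) \<le> e * (s - r)"
        and h: "poly_approx N h" "\<And>z. z \<in> N \<Longrightarrow> norm (I s t z - h z) \<le> e * (t - s)"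
        using trans unfolding P_def by (meson order_trans)
      have "norm (I r t z - (g z + h z)) \<le> e * (t - r)" if "z \<in> N" for z
      proof -
        have "linepath a b s \<in> closed_segment (linepath a b r) (linepath a b t)"
        proof (cases "r = t")
          case False
          have "linepath a b s = linepath (linepath a b r) (linepath a b t) ((s - r) / (t - r))"
          proof -
            have "linepath (linepath a b r) (linepath a b t) ((s - r) / (t - r))
                = linepath a b r + ((s - r) / (t - r)) *\<^sub>R (linepath a b t - linepath a b r)"
              by (simp add: linepath_def algebra_simps)
            also have "\<dots> = linepath a b r + (s - r) *\<^sub>R (b - a)" using False by (simp add: ldiff)
            also have "\<dots> = linepath a b s" using ldiff[of s r] by (simp add: algebra_simps)
            finally show ?thesis ..
          qed
          moreover have "(s - r) / (t - r) \<in> {0..1}" using False trans(3,4) by (auto simp: divide_simps)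
          ultimately show ?thesis by (metis imageI path_image_def path_image_linepath)
        qed (use trans in auto)
        then have "I r t z = I r s z + I s t z"
          unfolding I_def using rt trans that
          by (intro contour_integral_split_linepath continuous_on_subset[OF cont sub]) auto
        then have "I r t z - (g z + h z) = (I r s z - g z) + (I s t z - h z)" by simp
        then have "norm (I r t z - (g z + h z)) \<le> norm (I r s z - g z) + norm (I s t z - h z)"
          by (metis norm_triangle_ineq)
        then show ?thesis using g(2)[OF that] h(2)[OF that] by (simp add: algebra_simps)
      qed
      then show "P r t" unfolding P_def using poly_approx_add[OF g(1) h(1)] by blast
    qed
  next
    case (local x)
    define c where "c = linepath a b x"
    have c: "c \<in> closed_segment a b" using lin local by (simp add: c_def)
    have "P s t" if st: "0 \<le> s" "s \<le> x" "x \<le> t" "t \<le> 1" "t - s < d / (norm (b - a) + 1)" for s t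
    proof -
      define g where "g z = (linepath a b t - linepath a b s) * f c * (1 / (c - z))" for z
      have "poly_approx N g"
        unfolding g_def by (intro poly_approx_mult N poly_approx_const approx c)
      moreover have "norm (I s t z - g z) \<le> e * (t - s)" if "z \<in> N" for z
      proof -
        have int: "((\<lambda>w. f w / (w - z)) has_contour_integral I s t z) (linepath (linepath a b s) (linepath a b t))"
          unfolding I_def using st \<open>z \<in> N\<close>
          by (intro has_contour_integral_integral contour_integrable_continuous_linepath
              continuous_on_subset[OF cont sub]) auto
        have "((\<lambda>w. f w / (w - z) - f c / (c - z)) has_contour_integral I s t z - g z)
            (linepath (linepath a b s) (linepath a b t))"
          using has_contour_integral_diff[OF int has_contour_integral_const_linepath[of "f c / (c - z)"]]
          by (simp add: g_def mult_ac)
        then have "norm (I s t z - g z) \<le> e' * norm (linepath a b t - linepath a b s)"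
        proof (rule has_contour_integral_bound_linepath)
          show "0 \<le> e'" using \<open>e' > 0\<close> by simp
          fix w assume w: "w \<in> closed_segment (linepath a b s) (linepath a b t)"
          have nd: "norm (linepath a b v - linepath a b u) < d" if "s \<le> u" "u \<le> v" "v \<le> t" for u v
          proof -
            have "norm (linepath a b v - linepath a b u) = (v - u) * norm (b - a)"
              using that by (simp add: ldiff)
            also have "\<dots> \<le> (t - s) * (norm (b - a) + 1)" using that by (intro mult_mono) auto
            also have "\<dots> < d" using st(5) by (simp add: pos_less_divide_eq add_nonneg_pos)
            finally show ?thesis .
          qed
          have "closed_segment (linepath a b s) (linepath a b t) \<subseteq> ball c d"
            using nd[of s x] nd[of x t] st
            by (intro closed_segment_subset) (auto simp: c_def dist_norm norm_minus_commute)
          then have "dist (w, z) (c, z) < d" using w by (auto simp: dist_Pair_Pair dist_commute)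
          moreover have "w \<in> closed_segment a b" using w sub[of s t] st by auto
          ultimately have "dist (k (w, z)) (k (c, z)) < e'"
            using c \<open>z \<in> N\<close> by (intro d(2)) auto
          then show "norm (f w / (w - z) - f c / (c - z)) \<le> e'" by (simp add: k_def dist_norm)
        qed
        also have "\<dots> = (t - s) * (e' * norm (b - a))" using st by (simp add: ldiff)
        also have "\<dots> \<le> (t - s) * e"
          using st \<open>e > 0\<close> unfolding e'_def
          by (intro mult_left_mono) (auto simp: divide_simps add_nonneg_pos)
        finally show ?thesis by (simp add: mult.commute)
      qed
      ultimately show ?thesis unfolding P_def by blast
    qed
    moreover have "d / (norm (b - a) + 1) > 0" using d(1) by (simp add: add_nonneg_pos)
    ultimately show ?case using local by blast
  qed
  then show "\<exists>g. poly_approx N g \<and>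
      (\<forall>z\<in>N. norm (contour_integral (linepath a b) (\<lambda>w. f w / (w - z)) - g z) \<le> e)"
    by (simp add: P_def I_def linepath_def)
qed

text \<open>Each pole on the segment comes with its own neighbourhood of \<open>L\<close>;
  compactness of the segment leaves finitely many radii, and the smallest works for all
  poles.\<close>

lemma poly_approx_cauchy_integral_near:
  fixes L :: "complex set"
  assumes L: "compact L" "connected (- L)" and disj: "closed_segment a b \<inter> L = {}"
    and contf: "continuous_on (closed_segment a b) f"
  obtains r where "r > 0" "closed_segment a b \<inter> (\<Union>x\<in>L. cball x r) = {}"
    "poly_approx (\<Union>x\<in>L. cball x r) (\<lambda>z. contour_integral (linepath a b) (\<lambda>w. f w / (w - z)))"
proof -
  have "\<forall>w\<in>closed_segment a b. \<exists>r>0. \<forall>c\<in>ball w r. poly_approx (\<Union>x\<in>L. cball x r) (\<lambda>z. 1 / (c - z))"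
  proof
    fix w assume "w \<in> closed_segment a b"
    then have "w \<notin> L" using disj by blast
    from poly_approx_cauchy_kernel_near[OF L this]
    show "\<exists>r>0. \<forall>c\<in>ball w r. poly_approx (\<Union>x\<in>L. cball x r) (\<lambda>z. 1 / (c - z))" by metis
  qed
  then obtain R where R: "\<And>w. w \<in> closed_segment a b \<Longrightarrow> R w > 0"
    "\<And>w c. w \<in> closed_segment a b \<Longrightarrow> c \<in> ball w (R w) \<Longrightarrow>
       poly_approx (\<Union>x\<in>L. cball x (R w)) (\<lambda>z. 1 / (c - z))"
    by metis
  obtain W where W: "W \<subseteq> closed_segment a b" "finite W" "closed_segment a b \<subseteq> (\<Union>w\<in>W. ball w (R w))"
    using compactE_image[OF compact_segment, of "closed_segment a b" "\<lambda>w. ball w (R w)" a b] R(1)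
    by (metis (no_types, lifting) UN_I centre_in_ball open_ball subsetI)
  obtain d where d: "d > 0" "\<And>x z. x \<in> closed_segment a b \<Longrightarrow> z \<in> L \<Longrightarrow> d \<le> dist x z"
    using separate_compact_closed[OF compact_segment compact_imp_closed[OF \<open>compact L\<close>] disj] by blast
  define r where "r = Min (insert (d / 2) (R ` W))"
  have r: "r > 0" "r < d" "\<And>w. w \<in> W \<Longrightarrow> r \<le> R w"
  proof -
    show "r > 0" unfolding r_def using W R(1) d(1) by (subst Min_gr_iff) auto
    have "r \<le> d / 2" unfolding r_def using W(2) by (intro Min_le) auto
    then show "r < d" using d(1) by linarith
    show "r \<le> R w" if "w \<in> W" for w unfolding r_def using W(2) that by (intro Min_le) auto
  qed
  show ?thesis
  proof (rule that[OF r(1)])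
    show disj': "closed_segment a b \<inter> (\<Union>x\<in>L. cball x r) = {}"
    proof safe
      fix x y assume "x \<in> closed_segment a b" "y \<in> L" "x \<in> cball y r"
      then show "x \<in> {}" using d(2)[of x y] r(2) by (simp add: dist_commute)
    qed
    show "poly_approx (\<Union>x\<in>L. cball x r) (\<lambda>z. contour_integral (linepath a b) (\<lambda>w. f w / (w - z)))"
    proof (rule poly_approx_cauchy_integral[OF compact_minkowski_sum_cball[OF L(1)] disj' contf])
      fix c assume "c \<in> closed_segment a b"
      then obtain w where w: "w \<in> W" "c \<in> ball w (R w)" using W(3) by blast
      then have "poly_approx (\<Union>x\<in>L. cball x (R w)) (\<lambda>z. 1 / (c - z))" using R(2) W(1) by blast
      then show "poly_approx (\<Union>x\<in>L. cball x r) (\<lambda>z. 1 / (c - z))"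
        using r(3)[OF w(1)] by (elim poly_approx_subset) force
    qed
  qed
qed

text \<open>The complement is the union of the outside of the disc with the components of
  \<open>- F\<close>; each of these is unbounded and so meets the connected outside.\<close>

lemma connected_complement_Int_cball:
  fixes F :: "complex set"
  assumes "\<And>C. C \<in> components (- F) \<Longrightarrow> \<not> bounded C"
  shows "connected (- (F \<inter> cball 0 R))"
proof -
  let ?D = "- cball (0::complex) R"
  have D: "connected ?D" by (intro connected_complement_bounded_convex) auto
  have "?D \<noteq> {}"
    using bounded_subset[OF bounded_cball, of UNIV "0::complex" R] not_bounded_UNIV by auto
  have "connected (\<Union>(insert ?D ((\<lambda>C. C \<union> ?D) ` components (- F))))"
  proof (rule connected_Union)
    show "\<Inter> (insert ?D ((\<lambda>C. C \<union> ?D) ` components (- F))) \<noteq> {}" using \<open>?D \<noteq> {}\<close> by blast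
    fix S assume "S \<in> insert ?D ((\<lambda>C. C \<union> ?D) ` components (- F))"
    then consider "S = ?D" | C where "C \<in> components (- F)" "S = C \<union> ?D" by blast
    then show "connected S"
    proof cases
      case 2
      have "C \<inter> ?D \<noteq> {}"
        using assms[OF 2(1)] bounded_subset[OF bounded_cball, of C "0::complex" R] by blast
      then show ?thesis using 2 D in_components_connected by (auto intro: connected_Un)
    qed (use D in simp)
  qed
  moreover have "\<Union>(insert ?D ((\<lambda>C. C \<union> ?D) ` components (- F))) = - (F \<inter> cball 0 R)"
    using Union_components[of "- F"] by auto
  ultimately show ?thesis by simp
qed

section \<open>Cauchy integrals over a square grid\<close>

type_synonym cell = "int \<times> int"
type_synonym edge = "bool \<times> cell"

text \<open>A pair of integers denotes both a lattice point and the square cell that has this point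
  as its lower left corner.\<close>

definition node :: "real \<Rightarrow> cell \<Rightarrow> complex" where
  "node d q = Complex (d * of_int (fst q)) (d * of_int (snd q))"

definition centre :: "real \<Rightarrow> cell \<Rightarrow> complex" where
  "centre d q = node d q + Complex (d / 2) (d / 2)"

definition east :: "cell \<Rightarrow> cell" where "east q = (fst q + 1, snd q)"
definition west :: "cell \<Rightarrow> cell" where "west q = (fst q - 1, snd q)"
definition north :: "cell \<Rightarrow> cell" where "north q = (fst q, snd q + 1)"
definition south :: "cell \<Rightarrow> cell" where "south q = (fst q, snd q - 1)"

text \<open>The edge \<open>(True, q)\<close> is the lower side of the cell \<open>q\<close>, and \<open>(False, q)\<close> is its left
  side; each edge is oriented so that \<open>left_cell\<close> lies to its left.\<close>

definition edge_end :: "edge \<Rightarrow> cell" where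
  "edge_end e = (if fst e then east (snd e) else north (snd e))"

definition left_cell :: "edge \<Rightarrow> cell" where
  "left_cell e = (if fst e then snd e else west (snd e))"

definition right_cell :: "edge \<Rightarrow> cell" where
  "right_cell e = (if fst e then south (snd e) else snd e)"

definition edge_path :: "real \<Rightarrow> edge \<Rightarrow> real \<Rightarrow> complex" where
  "edge_path d e = linepath (node d (snd e)) (node d (edge_end e))"

definition edge_seg :: "real \<Rightarrow> edge \<Rightarrow> complex set" where
  "edge_seg d e = closed_segment (node d (snd e)) (node d (edge_end e))"

definition cell_path :: "real \<Rightarrow> cell \<Rightarrow> real \<Rightarrow> complex" where
  "cell_path d q = rectpath (node d q) (node d (north (east q)))"

text \<open>A superset of the sides of the cells of \<open>S\<close>: the upper side of
  \<open>q\<close> is the lower side of \<open>north q\<close>, and its right side is the left side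
  of \<open>east q\<close>. Edges with no neighbour in \<open>S\<close> will contribute
  zero.\<close>

definition edges_of :: "cell set \<Rightarrow> edge set" where
  "edges_of S = UNIV \<times> (S \<union> north ` S \<union> east ` S)"

definition off_grid :: "real \<Rightarrow> complex \<Rightarrow> bool" where
  "off_grid d z \<longleftrightarrow> (\<forall>n::int. Re z \<noteq> d * of_int n \<and> Im z \<noteq> d * of_int n)"

definition cell_of :: "real \<Rightarrow> complex \<Rightarrow> cell" where
  "cell_of d z = (\<lfloor>Re z / d\<rfloor>, \<lfloor>Im z / d\<rfloor>)"

lemmas cell_defs = node_def east_def west_def north_def south_def

section \<open>Elementary geometry of the grid\<close>

text \<open>On the diagonal through \<open>z\<close> only countably many parameters hit a grid line.
  This serves to extend estimates from points off the grid to all points by continuity.\<close>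

lemma off_grid_dense:
  assumes "0 < \<eta>"
  obtains t where "0 < t" "t < \<eta>" "off_grid d (z + of_real t * Complex 1 1)"
proof -
  have "countable (range (\<lambda>n::int. d * of_int n - Re z) \<union> range (\<lambda>n::int. d * of_int n - Im z))"
    by auto
  moreover have "uncountable {0<..<\<eta>}" using assms by (simp add: uncountable_open_interval)
  ultimately have "\<not> {0<..<\<eta>} \<subseteq> range (\<lambda>n::int. d * of_int n - Re z) \<union> range (\<lambda>n::int. d * of_int n - Im z)"
    using countable_subset by blast
  then obtain t where "t \<in> {0<..<\<eta>}" "t \<notin> range (\<lambda>n::int. d * of_int n - Re z)"
    "t \<notin> range (\<lambda>n::int. d * of_int n - Im z)"
    by blast
  then show ?thesis
    by (intro that[of t]) (auto simp: off_grid_def image_iff algebra_simps)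
qed

lemma edge_path_props [simp]:
  "valid_path (edge_path d e)" "path_image (edge_path d e) = edge_seg d e"
  by (simp_all add: edge_path_def edge_seg_def)

lemma off_grid_not_edge:
  assumes "off_grid d z"
  shows "z \<notin> edge_seg d e"
proof
  assume z: "z \<in> edge_seg d e"
  obtain b i j where e: "e = (b, i, j)" by (metis prod.collapse)
  show False
  proof (cases b)
    case True
    then have "Im z = d * of_int j"
      using z by (auto simp: e edge_seg_def edge_end_def cell_defs closed_segment_same_Im)
    then show False using assms by (auto simp: off_grid_def)
  next
    case False
    then have "Re z = d * of_int i"
      using z by (auto simp: e edge_seg_def edge_end_def cell_defs closed_segment_same_Re)
    then show False using assms by (auto simp: off_grid_def)
  qed
qed

lemma dist_centre_le:
  assumes "0 < d" "\<bar>Re z - Re (centre d q)\<bar> \<le> d / 2" "\<bar>Im z - Im (centre d q)\<bar> \<le> d / 2"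
  shows "dist z (centre d q) \<le> d"
proof -
  have "dist z (centre d q) \<le> \<bar>Re (z - centre d q)\<bar> + \<bar>Im (z - centre d q)\<bar>"
    unfolding dist_norm by (rule cmod_le)
  then show ?thesis using assms by simp
qed

lemma dist_edge_centre:
  assumes "0 < d" and w: "w \<in> edge_seg d e" and c: "c = left_cell e \<or> c = right_cell e"
  shows "dist w (centre d c) \<le> d"
proof -
  have "node d (snd e) \<in> cball (centre d c) d" "node d (edge_end e) \<in> cball (centre d c) d"
    using c assms(1) unfolding mem_cball dist_commute[of "centre d c"]
    by (intro dist_centre_le;
        auto simp: centre_def edge_end_def left_cell_def right_cell_def cell_defs algebra_simps split: if_splits)+
  then have "edge_seg d e \<subseteq> cball (centre d c) d"
    unfolding edge_seg_def by (intro closed_segment_subset) auto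
  then show ?thesis using w by (auto simp: dist_commute)
qed

lemma edge_length:
  assumes "0 < d"
  shows "norm (node d (edge_end e) - node d (snd e)) = d"
proof -
  have "node d (edge_end e) - node d (snd e) = (if fst e then of_real d else of_real d * \<i>)"
    by (auto simp: edge_end_def cell_defs complex_eq_iff algebra_simps)
  then show ?thesis using assms by (simp add: norm_mult)
qed

section \<open>Cauchy integrals along cells and edges\<close>

text \<open>The rectangle runs counterclockwise, whereas its upper and left sides are oriented to
  the east and to the north; hence the two minus signs.\<close>

lemma contour_integral_cell_path:
  assumes "\<And>e. continuous_on (edge_seg d e) f"
  shows "contour_integral (cell_path d q) f =
      contour_integral (edge_path d (True, q)) f + contour_integral (edge_path d (False, east q)) f
      - contour_integral (edge_path d (True, north q)) f - contour_integral (edge_path d (False, q)) f"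
proof -
  have int: "f contour_integrable_on edge_path d e" for e
    unfolding edge_path_def using assms[of e]
    by (intro contour_integrable_continuous_linepath) (simp add: edge_seg_def)
  have ev: "east (north q) = north (east q)" by (simp add: cell_defs)
  have rev: "contour_integral (linepath (node d (edge_end e)) (node d (snd e))) f
      = - contour_integral (edge_path d e) f"
    "f contour_integrable_on linepath (node d (edge_end e)) (node d (snd e))" for e
  proof -
    have "continuous_on (closed_segment (node d (edge_end e)) (node d (snd e))) f"
      using assms[of e] by (simp add: edge_seg_def closed_segment_commute)
    then show "contour_integral (linepath (node d (edge_end e)) (node d (snd e))) f
        = - contour_integral (edge_path d e) f"
      "f contour_integrable_on linepath (node d (edge_end e)) (node d (snd e))"
      unfolding edge_path_def
      by (simp_all add: contour_integral_reverse_linepath contour_integrable_continuous_linepath)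
  qed
  have "cell_path d q = linepath (node d q) (node d (east q)) +++
      linepath (node d (east q)) (node d (north (east q))) +++
      linepath (node d (north (east q))) (node d (north q)) +++ linepath (node d (north q)) (node d q)"
    by (simp add: cell_path_def rectpath_def Let_def cell_defs)
  then show ?thesis
    using int[of "(True, q)"] int[of "(False, east q)"] rev[of "(True, north q)"] rev[of "(False, q)"]
    by (simp add: edge_path_def edge_end_def ev)
qed

text \<open>Off the grid, \<open>z\<close> lies either inside the open square or outside the closed
  one, so the winding number is 1 or 0.\<close>

lemma contour_integral_cell_kernel:
  assumes "0 < d" and hol: "f holomorphic_on UNIV" and z: "off_grid d z"
  shows "contour_integral (cell_path d q) (\<lambda>w. f w / (w - z))
       = (if q = cell_of d z then 2 * pi * \<i> * f z else 0)"
proof -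
  obtain i j where q: "q = (i, j)" by (metis prod.collapse)
  have dir: "Re (node d q) \<le> Re (node d (north (east q)))" "Im (node d q) \<le> Im (node d (north (east q)))"
    using assms(1) by (auto simp: cell_defs)
  \<comment> \<open>The floor allows equality on the left; off the grid equality never occurs, which
    gives the open interval.\<close>
  have iff: "n = \<lfloor>x / d\<rfloor> \<longleftrightarrow> d * of_int n < x \<and> x < d * (of_int n + 1)"
    if "\<And>n::int. x \<noteq> d * of_int n" for x n
  proof -
    have "n = \<lfloor>x / d\<rfloor> \<longleftrightarrow> d * of_int n \<le> x \<and> x < d * (of_int n + 1)"
      using assms(1) by (auto simp: floor_eq_iff le_divide_eq divide_less_eq mult.commute eq_commute[of n])
    then show ?thesis using that[of n] by auto
  qed
  have box: "z \<in> box (node d q) (node d (north (east q))) \<longleftrightarrow> q = cell_of d z"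
    using z by (auto simp: q cell_of_def off_grid_def in_box_complex_iff cell_defs iff)
  have neq: "x \<noteq> d * (of_int n + 1)" if "\<And>n::int. x \<noteq> d * of_int n" for x n
    using that[of "n + 1"] by simp
  have ne: "d * of_int i \<noteq> Re z" "d * of_int j \<noteq> Im z"
    using z unfolding off_grid_def by metis+
  have cbox: "z \<in> cbox (node d q) (node d (north (east q))) \<longleftrightarrow> z \<in> box (node d q) (node d (north (east q)))"
    using z neq[of "Re z" i] neq[of "Im z" j] ne
    by (auto simp: q off_grid_def in_box_complex_iff in_cbox_complex_iff cell_defs order.order_iff_strict)
  have "z \<notin> path_image (cell_path d q)"
    unfolding cell_path_def path_image_rectpath_cbox_minus_box[OF dir] using cbox by blast
  then have "((\<lambda>w. f w / (w - z)) has_contour_integral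
      (2 * pi * \<i> * winding_number (cell_path d q) z * f z)) (cell_path d q)"
    using hol by (intro Cauchy_integral_formula_convex_simple[of UNIV]) (auto simp: cell_path_def)
  moreover have "winding_number (cell_path d q) z = (if q = cell_of d z then 1 else 0)"
    using box cbox winding_number_rectpath winding_number_rectpath_outside[OF dir]
    unfolding cell_path_def by auto
  ultimately show ?thesis by (auto dest!: contour_integral_unique)
qed

text \<open>Double counting: \<open>q\<close> lies to the left of its lower and right sides and to
  the right of its upper and left sides. The premise \<open>zero\<close> discards all cells outside
  \<open>S\<close>.\<close>

lemma edge_sum_eq_cell_sum:
  fixes h :: "bool \<Rightarrow> cell \<Rightarrow> cell \<Rightarrow> complex"
  assumes "finite S" and zero: "\<And>b q c. c \<notin> S \<Longrightarrow> h b q c = 0"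
  shows "(\<Sum>e\<in>edges_of S. h (fst e) (snd e) (left_cell e) - h (fst e) (snd e) (right_cell e))
      = (\<Sum>q\<in>S. h True q q + h False (east q) q - h True (north q) q - h False q q)"
proof -
  let ?E = "S \<union> north ` S \<union> east ` S"
  have fin: "finite ?E" using assms(1) by auto
  have inj: "inj_on north S" "inj_on east S"
    by (auto simp: inj_on_def cell_defs)
  have ns: "south (north q) = q" "west (east q) = q" "north (south q) = q" "east (west q) = q" for q
    by (simp_all add: cell_defs)
  have base: "(\<Sum>q\<in>?E. h b q q) = (\<Sum>q\<in>S. h b q q)" for b
    using fin zero by (intro sum.mono_neutral_right) auto
  have "(\<Sum>q\<in>?E. h True q (south q)) = (\<Sum>q\<in>north ` S. h True q (south q))"
  proof (intro sum.mono_neutral_right[OF fin] ballI zero)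
    fix q assume "q \<in> ?E - north ` S"
    then show "south q \<notin> S" using ns(3)[of q] by (metis Diff_iff imageI)
  qed auto
  also have "\<dots> = (\<Sum>q\<in>S. h True (north q) q)"
    by (simp add: sum.reindex inj ns)
  finally have s: "(\<Sum>q\<in>?E. h True q (south q)) = (\<Sum>q\<in>S. h True (north q) q)" .
  have "(\<Sum>q\<in>?E. h False q (west q)) = (\<Sum>q\<in>east ` S. h False q (west q))"
  proof (intro sum.mono_neutral_right[OF fin] ballI zero)
    fix q assume "q \<in> ?E - east ` S"
    then show "west q \<notin> S" using ns(4)[of q] by (metis Diff_iff imageI)
  qed auto
  also have "\<dots> = (\<Sum>q\<in>S. h False (east q) q)"
    by (simp add: sum.reindex inj ns)
  finally have w: "(\<Sum>q\<in>?E. h False q (west q)) = (\<Sum>q\<in>S. h False (east q) q)" .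
  have "(\<Sum>e\<in>edges_of S. h (fst e) (snd e) (left_cell e) - h (fst e) (snd e) (right_cell e))
      = (\<Sum>b\<in>UNIV. \<Sum>q\<in>?E. h b q (left_cell (b, q)) - h b q (right_cell (b, q)))"
    unfolding edges_of_def using assms(1) by (subst sum.Sigma) (auto intro!: sum.cong)
  also have "\<dots> = (\<Sum>q\<in>?E. h True q q - h True q (south q)) + (\<Sum>q\<in>?E. h False q (west q) - h False q q)"
    by (simp add: UNIV_bool left_cell_def right_cell_def)
  also have "\<dots> = (\<Sum>q\<in>S. h True q q + h False (east q) q - h True (north q) q - h False q q)"
    unfolding sum_subtractf sum.distrib base s w by simp
  finally show ?thesis .
qed

text \<open>The Cauchy integral, without the factor \<open>1 / (2 * pi * \<i>)\<close>, of the jump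
  across an edge of the piecewise function given by \<open>f\<close>.\<close>

definition edge_term :: "real \<Rightarrow> (cell \<Rightarrow> complex \<Rightarrow> complex) \<Rightarrow> edge \<Rightarrow> complex \<Rightarrow> complex" where
  "edge_term d f e z =
     contour_integral (edge_path d e) (\<lambda>w. (f (left_cell e) w - f (right_cell e) w) / (w - z))"

text \<open>Split by cells and regrouped, the sum consists of Cauchy integrals around the cells of
  \<open>S\<close>, of which at most the one containing \<open>z\<close> contributes.\<close>

lemma sum_edge_terms:
  assumes "0 < d" "finite S" and hol: "\<And>q. q \<in> S \<Longrightarrow> f q holomorphic_on UNIV"
    and zero: "\<And>q. q \<notin> S \<Longrightarrow> f q = (\<lambda>_. 0)" and z: "off_grid d z"
  shows "(\<Sum>e\<in>edges_of S. edge_term d f e z) = 2 * pi * \<i> * f (cell_of d z) z"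
proof -
  have hol': "f q holomorphic_on UNIV" for q using hol zero by (cases "q \<in> S") auto
  have cont: "continuous_on (edge_seg d e) (\<lambda>w. f q w / (w - z))" for e q
  proof -
    have "continuous_on (edge_seg d e) (f q)"
      using hol' holomorphic_on_imp_continuous_on continuous_on_subset by blast
    then show ?thesis using off_grid_not_edge[OF z, of e] by (intro continuous_intros) auto
  qed
  define h where "h b c q = contour_integral (edge_path d (b, c)) (\<lambda>w. f q w / (w - z))" for b c q
  have "edge_term d f e z = h (fst e) (snd e) (left_cell e) - h (fst e) (snd e) (right_cell e)" for e
    unfolding edge_term_def h_def diff_divide_distrib prod.collapse
    using cont[of e "left_cell e"] cont[of e "right_cell e"]
    by (intro contour_integral_diff)
      (auto simp: edge_path_def edge_seg_def intro!: contour_integrable_continuous_linepath)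
  then have "(\<Sum>e\<in>edges_of S. edge_term d f e z)
      = (\<Sum>q\<in>S. h True q q + h False (east q) q - h True (north q) q - h False q q)"
    using edge_sum_eq_cell_sum[OF \<open>finite S\<close>, of h] zero by (simp add: h_def)
  also have "\<dots> = (\<Sum>q\<in>S. contour_integral (cell_path d q) (\<lambda>w. f q w / (w - z)))"
    by (intro sum.cong refl) (simp add: h_def contour_integral_cell_path[OF cont])
  also have "\<dots> = (\<Sum>q\<in>S. if q = cell_of d z then 2 * pi * \<i> * f q z else 0)"
    using hol by (intro sum.cong refl) (simp add: contour_integral_cell_kernel[OF assms(1) _ z])
  also have "\<dots> = 2 * pi * \<i> * f (cell_of d z) z"
    using \<open>finite S\<close> zero[of "cell_of d z"] by (simp add: sum.delta)
  finally show ?thesis .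
qed

text \<open>A Cauchy integral with continuous density is complex differentiable off the path, by
  \<open>Cauchy_next_derivative\<close> for the exponent 1.\<close>

lemma holomorphic_on_edge_term:
  assumes "f (left_cell e) holomorphic_on UNIV" "f (right_cell e) holomorphic_on UNIV"
    and "open U" "U \<inter> edge_seg d e = {}"
  shows "edge_term d f e holomorphic_on U"
proof -
  have cont: "continuous_on (edge_seg d e) (\<lambda>w. f (left_cell e) w - f (right_cell e) w)"
    by (intro continuous_intros)
      (use assms holomorphic_on_imp_continuous_on continuous_on_subset in blast)+
  have int: "((\<lambda>w. (f (left_cell e) w - f (right_cell e) w) / (w - z) ^ 1) has_contour_integral
      edge_term d f e z) (edge_path d e)" if "z \<in> U - path_image (edge_path d e)" for z
    unfolding edge_term_def power_one_right unfolding edge_path_def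
    using that
    by (intro has_contour_integral_integral contour_integrable_continuous_linepath
        continuous_on_divide continuous_on_diff[OF continuous_on_id continuous_on_const]
        cont[unfolded edge_seg_def])
      (auto simp: edge_seg_def)
  have "edge_term d f e field_differentiable at z" if "z \<in> U" for z
    unfolding field_differentiable_def
    using Cauchy_next_derivative(2)[OF _ _ int _ \<open>open U\<close>, where B = "norm (node d (edge_end e) - node d (snd e))"]
      that assms(4) cont
    by (force simp: edge_path_def edge_seg_def)
  then show ?thesis
    using field_differentiable_at_within holomorphic_on_def by blast
qed

lemma card_edges_of: 
  assumes "finite S"
  shows "card (edges_of S) \<le> 6 * card S" "finite (edges_of S)"
proof -
  show "finite (edges_of S)" using assms by (auto simp: edges_of_def)
  have "card (S \<union> north ` S \<union> east ` S) \<le> card (S \<union> north ` S) + card (east ` S)"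
    by (rule card_Un_le)
  also have "\<dots> \<le> (card S + card (north ` S)) + card (east ` S)"
    by (intro add_mono card_Un_le) auto
  also have "\<dots> \<le> (card S + card S) + card S"
    using assms by (intro add_mono card_image_le) auto
  finally show "card (edges_of S) \<le> 6 * card S"
    by (simp add: edges_of_def card_cartesian_product UNIV_bool)
qed

text \<open>Both indices lie between \<open>- int n\<close> and \<open>int n\<close>, where
  \<open>n\<close> is the integer part of \<open>(R + 9) / d\<close>; since
  \<open>d \<le> 1\<close>, each axis offers at most \<open>(2 * R + 19) / d\<close>
  indices.\<close>

lemma card_cells_near:
  assumes d: "0 < d" "d \<le> 1" and "1 \<le> R" and S: "\<And>q. q \<in> S \<Longrightarrow> norm (centre d q) \<le> R + 8 * d"
  shows "finite S" "real (card S) \<le> (2 * R + 19)\<^sup>2 / d\<^sup>2"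
proof -
  define n where "n = nat \<lfloor>(R + 9) / d\<rfloor>"
  have "(R + 9) / d \<ge> 0" using d \<open>1 \<le> R\<close> by simp
  then have n: "real n \<le> (R + 9) / d" "\<And>k. of_int k \<le> (R + 9) / d \<Longrightarrow> k \<le> int n"
    unfolding n_def by (auto simp: le_floor_iff)
  have bound: "\<bar>k\<bar> \<le> int n" if "\<bar>d * of_int k + d / 2\<bar> \<le> R + 8 * d" for k
  proof (rule n(2))
    have "d * of_int \<bar>k\<bar> = \<bar>d * of_int k\<bar>" using d(1) by (simp add: abs_mult)
    also have "\<dots> \<le> R + 9" using that d by linarith
    finally show "of_int \<bar>k\<bar> \<le> (R + 9) / d" using d(1) by (simp add: pos_le_divide_eq mult.commute)
  qed
  have sub: "S \<subseteq> {-int n..int n} \<times> {-int n..int n}"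
  proof
    fix q assume "q \<in> S"
    then have "\<bar>Re (centre d q)\<bar> \<le> R + 8 * d" "\<bar>Im (centre d q)\<bar> \<le> R + 8 * d"
      using S abs_Re_le_cmod[of "centre d q"] abs_Im_le_cmod[of "centre d q"] by fastforce+
    then have "\<bar>fst q\<bar> \<le> int n" "\<bar>snd q\<bar> \<le> int n"
      using bound by (auto simp: centre_def node_def)
    then show "q \<in> {-int n..int n} \<times> {-int n..int n}"
      by (cases q) auto
  qed
  then show "finite S" by (rule finite_subset) auto
  have "card S \<le> (2 * n + 1) * (2 * n + 1)"
    using card_mono[OF _ sub] by (simp add: card_cartesian_product nat_add_distrib nat_mult_distrib)
  then have "real (card S) \<le> real ((2 * n + 1) * (2 * n + 1))" by (rule of_nat_mono)
  also have "\<dots> = (2 * real n + 1)\<^sup>2" by (simp add: power2_eq_square algebra_simps)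
  also have "\<dots> \<le> ((2 * R + 19) / d)\<^sup>2"
  proof (rule power_mono)
    have "2 * real n + 1 \<le> 2 * ((R + 9) / d) + 1 / d"
      using n(1) d by (intro add_mono mult_left_mono) auto
    then show "2 * real n + 1 \<le> (2 * R + 19) / d" by (simp add: add_divide_distrib)
  qed simp
  finally show "real (card S) \<le> (2 * R + 19)\<^sup>2 / d\<^sup>2" by (simp add: power_divide)
qed

section \<open>Gluing a compatible family of entire functions\<close>

lemma poly_approx_near_sum:
  fixes L :: "complex set"
  assumes "finite I" and "\<And>i. i \<in> I \<Longrightarrow> \<exists>r>0. poly_approx (\<Union>x\<in>L. cball x r) (f i)"
  obtains r where "r > 0" "poly_approx (\<Union>x\<in>L. cball x r) (\<lambda>z. \<Sum>i\<in>I. f i z)"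
proof -
  obtain R where R: "\<And>i. i \<in> I \<Longrightarrow> R i > 0" "\<And>i. i \<in> I \<Longrightarrow> poly_approx (\<Union>x\<in>L. cball x (R i)) (f i)"
    using assms(2) by metis
  define r where "r = Min (insert 1 (R ` I))"
  have r: "r > 0" "\<And>i. i \<in> I \<Longrightarrow> r \<le> R i"
  proof -
    show "r > 0" unfolding r_def using assms(1) R(1) by (subst Min_gr_iff) auto
    show "r \<le> R i" if "i \<in> I" for i unfolding r_def using assms(1) that by (intro Min_le) auto
  qed
  have "poly_approx (\<Union>x\<in>L. cball x r) (f i)" if "i \<in> I" for i
    by (rule poly_approx_subset[OF R(2)[OF that]]) (use r(2)[OF that] in auto)
  then show ?thesis
    using that[OF r(1) poly_approx_sum[OF assms(1)]] by blast
qed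

text \<open>The glued function is the Cauchy integral of the locally chosen \<open>P (y q)\<close> over the edges
  between cells near \<open>L\<close> and cells away from it. Near a given \<open>x\<close> one may replace
  \<open>P (y q)\<close> by \<open>P x\<close> in all cells close to \<open>x\<close>: this changes no such boundary edge, and the
  remaining jumps are small and sit on edges at distance at least \<open>d\<close>.\<close>

lemma glue_entire_family_at_scale:
  fixes P :: "complex \<Rightarrow> complex \<Rightarrow> complex"
  assumes L: "compact L" "connected (- L)" "L \<subseteq> cball 0 R" "1 \<le> R"
    and hol: "\<And>x. x \<in> L \<Longrightarrow> P x holomorphic_on UNIV"
    and compat: "\<And>x y z. x \<in> L \<Longrightarrow> y \<in> L \<Longrightarrow> dist x y \<le> 20 * d \<Longrightarrow> dist z x \<le> 20 * d
        \<Longrightarrow> norm (P x z - P y z) \<le> \<epsilon>"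
    and "0 \<le> \<epsilon>" and d: "0 < d" "d \<le> 1"
  obtains H r where "r > 0" "poly_approx (\<Union>x\<in>L. cball x r) H"
    "\<And>x. x \<in> L \<Longrightarrow> H holomorphic_on ball x (2 * d)"
    "\<And>x z. x \<in> L \<Longrightarrow> z \<in> ball x (2 * d) \<Longrightarrow> norm (H z - P x z) \<le> 6 * (2 * R + 19)\<^sup>2 / d\<^sup>2 * \<epsilon>"
proof -
  \<comment> \<open>The radii nest: \<open>8 * d\<close> for \<open>S\<close>, \<open>4 * d\<close>
    for the modification near a fixed \<open>x\<close>, at most \<open>2 * d\<close> between
    neighbouring centres, and \<open>2 * d\<close> for the discs of the estimate.\<close>
  define S where "S = {q. \<exists>x\<in>L. dist x (centre d q) < 8 * d}"
  have S8: "dist x (centre d q) \<ge> 8 * d" if "x \<in> L" "q \<notin> S" for x q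
    using that by (force simp: S_def)
  have near_centre: "norm (centre d q) \<le> R + 8 * d" if "q \<in> S" for q
  proof -
    obtain x where x: "x \<in> L" "dist x (centre d q) < 8 * d" using \<open>q \<in> S\<close> by (auto simp: S_def)
    then have "norm x \<le> R" using L(3) by auto
    moreover have "norm (centre d q) \<le> norm x + dist x (centre d q)"
      unfolding dist_norm by norm
    ultimately show ?thesis using x(2) by linarith
  qed
  note cardS = card_cells_near[OF d \<open>1 \<le> R\<close>, of S, OF near_centre]
  obtain y where y: "\<And>q. q \<in> S \<Longrightarrow> y q \<in> L" "\<And>q. q \<in> S \<Longrightarrow> dist (y q) (centre d q) < 8 * d"
  proof -
    have "\<forall>q\<in>S. \<exists>x. x \<in> L \<and> dist x (centre d q) < 8 * d" by (auto simp: S_def)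
    then show ?thesis using that by metis
  qed
  \<comment> \<open>\<open>Out\<close> separates \<open>S\<close> from its complement and carries
    \<open>H\<close>; the jumps on \<open>In\<close> make up the error.\<close>
  define Out where "Out = {e \<in> edges_of S. (left_cell e \<in> S) \<noteq> (right_cell e \<in> S)}"
  define In where "In = {e \<in> edges_of S. left_cell e \<in> S \<and> right_cell e \<in> S}"
  note finE = card_edges_of(2)[OF cardS(1)]
  have finOut: "finite Out" and finIn: "finite In" using finE by (auto simp: Out_def In_def)
  define f where "f q = (if q \<in> S then P (y q) else (\<lambda>_. 0))" for q
  define H where "H z = 1 / (2 * pi * \<i>) * (\<Sum>e\<in>Out. edge_term d f e z)" for z
  have holf: "f q holomorphic_on UNIV" for q using hol y(1) by (simp add: f_def)
  \<comment> \<open>An outer edge borders a cell outside \<open>S\<close>, whose centre is at least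
    \<open>8 * d\<close> away from \<open>L\<close>.\<close>
  have far: "7 * d \<le> dist w x" if "e \<in> Out" "w \<in> edge_seg d e" "x \<in> L" for e w x
  proof -
    obtain c where c: "c = left_cell e \<or> c = right_cell e" "c \<notin> S"
      using \<open>e \<in> Out\<close> unfolding Out_def by blast
    then have "dist w (centre d c) \<le> d" using dist_edge_centre d that by blast
    then show ?thesis
      using S8[OF \<open>x \<in> L\<close> c(2)] dist_triangle[of x "centre d c" w] by (simp add: dist_commute)
  qed
  have near: "\<exists>r>0. poly_approx (\<Union>x\<in>L. cball x r) (edge_term d f e)" if "e \<in> Out" for e
  proof -
    have "closed_segment (node d (snd e)) (node d (edge_end e)) \<inter> L = {}"
      using far[OF that, unfolded edge_seg_def] d(1) by force
    moreover have "continuous_on (closed_segment (node d (snd e)) (node d (edge_end e)))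
        (\<lambda>w. f (left_cell e) w - f (right_cell e) w)"
      using holf holomorphic_on_imp_continuous_on continuous_on_subset
      by (intro continuous_on_diff) blast+
    ultimately show ?thesis
      using poly_approx_cauchy_integral_near[OF L(1,2)] unfolding edge_term_def edge_path_def by metis
  qed
  obtain r where r: "r > 0" "poly_approx (\<Union>x\<in>L. cball x r) (\<lambda>z. \<Sum>e\<in>Out. edge_term d f e z)"
    by (rule poly_approx_near_sum[OF finOut near])
  have holH: "H holomorphic_on ball x (2 * d)" if "x \<in> L" for x
    unfolding H_def
  proof (intro holomorphic_intros holomorphic_on_edge_term holf)
    fix e assume "e \<in> Out"
    show "ball x (2 * d) \<inter> edge_seg d e = {}"
      using far[OF \<open>e \<in> Out\<close> _ that] d(1) by (force simp: dist_commute)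
  qed auto
  define M where "M = 6 * (2 * R + 19)\<^sup>2 / d\<^sup>2 * \<epsilon>"
  have off: "norm (H z - P x z) \<le> M" if x: "x \<in> L" and z: "z \<in> ball x (2 * d)" "off_grid d z" for x z
  proof -
    \<comment> \<open>On the cells of \<open>B\<close> the chosen function is replaced by
      \<open>P x\<close>, so that \<open>sum_edge_terms\<close> for \<open>f'\<close> returns
      \<open>P x z\<close>.\<close>
    define B where "B = {q. dist x (centre d q) < 4 * d}"
    define y' where "y' q = (if q \<in> B then x else y q)" for q
    define f' where "f' q = (if q \<in> S then P (y' q) else (\<lambda>_. 0))" for q
    have BS: "B \<subseteq> S"
      unfolding B_def S_def using x d(1) by (intro Collect_mono impI bexI[of _ x]) auto
    have y': "y' q \<in> L" "dist (y' q) (centre d q) < 8 * d" if "q \<in> S" for q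
      using that y x d(1) by (auto simp: y'_def B_def)
    have nbr: "dist (centre d (left_cell e)) (centre d (right_cell e)) \<le> 2 * d" for e
    proof -
      have "node d (snd e) \<in> edge_seg d e" by (simp add: edge_seg_def)
      then have "dist (node d (snd e)) (centre d (left_cell e)) \<le> d"
        "dist (node d (snd e)) (centre d (right_cell e)) \<le> d"
        using dist_edge_centre[OF d(1)] by blast+
      then show ?thesis
        using dist_triangle3[of "centre d (left_cell e)" "centre d (right_cell e)" "node d (snd e)"] by linarith
    qed
    \<comment> \<open>A neighbour of a cell of \<open>B\<close> has its centre within
      \<open>6 * d\<close> of \<open>x\<close> and so belongs to \<open>S\<close>; hence no outer
      edge borders \<open>B\<close>.\<close>
    have same: "edge_term d f' e z = edge_term d f e z" if "e \<in> Out" for e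
    proof -
      have "left_cell e \<notin> B \<and> right_cell e \<notin> B"
      proof -
        have "left_cell e \<in> S" if "right_cell e \<in> B"
          using that x nbr[of e] dist_triangle[of x "centre d (left_cell e)" "centre d (right_cell e)"] d(1)
          by (auto simp: B_def S_def dist_commute intro!: bexI[of _ x])
        moreover have "right_cell e \<in> S" if "left_cell e \<in> B"
          using that x nbr[of e] dist_triangle[of x "centre d (right_cell e)" "centre d (left_cell e)"] d(1)
          by (auto simp: B_def S_def intro!: bexI[of _ x])
        ultimately show ?thesis using \<open>e \<in> Out\<close> BS by (auto simp: Out_def)
      qed
      then show ?thesis by (simp add: edge_term_def f'_def f_def y'_def)
    qed
    \<comment> \<open>Two cells of \<open>B\<close> carry the same function. Otherwise the edge is
      at least \<open>d\<close> away from \<open>z\<close>, and the jump \<open>\<epsilon>\<close>,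
      the kernel bound \<open>1 / d\<close> and the length \<open>d\<close> multiply to
      \<open>\<epsilon>\<close>.\<close>
    have inner: "norm (edge_term d f' e z) \<le> \<epsilon>" if e: "e \<in> In" for e
    proof (cases "left_cell e \<in> B \<and> right_cell e \<in> B")
      case True
      then show ?thesis using BS \<open>0 \<le> \<epsilon>\<close> by (auto simp: edge_term_def f'_def y'_def)
    next
      case False
      then have "4 * d \<le> dist x (centre d (left_cell e)) \<or> 4 * d \<le> dist x (centre d (right_cell e))"
        by (auto simp: B_def not_less)
      then obtain c where c: "c = left_cell e \<or> c = right_cell e" "4 * d \<le> dist x (centre d c)"
        by blast
      have lS: "left_cell e \<in> S" and rS: "right_cell e \<in> S" using e by (auto simp: In_def)
      have dist: "d \<le> dist w z" if w: "w \<in> edge_seg d e" for w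
      proof -
        have "dist w (centre d c) \<le> d" using dist_edge_centre[OF d(1) w c(1)] .
        then have "3 * d \<le> dist x w" using c(2) dist_triangle[of x "centre d c" w] by linarith
        moreover have "dist x z < 2 * d" using z(1) by simp
        ultimately show ?thesis using dist_triangle[of x w z] by (simp add: dist_commute)
      qed
      \<comment> \<open>The base points are within \<open>8 * d\<close> of centres at most
        \<open>2 * d\<close> apart, so they are at most \<open>18 * d\<close> from each other and
        \<open>9 * d\<close> from \<open>w\<close>; \<open>20 * d\<close> covers both.\<close>
      have jump: "norm (f' (left_cell e) w - f' (right_cell e) w) \<le> \<epsilon>" if w: "w \<in> edge_seg d e" for w
      proof -
        have "dist w (centre d (left_cell e)) \<le> d" using dist_edge_centre[OF d(1) w] by blast
        then have 1: "dist w (y' (left_cell e)) \<le> 20 * d"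
          using y'(2)[OF lS] dist_triangle[of w "y' (left_cell e)" "centre d (left_cell e)"] d(1)
          by (simp add: dist_commute)
        have 2: "dist (y' (left_cell e)) (y' (right_cell e)) \<le> 20 * d"
          using y'(2)[OF lS] y'(2)[OF rS] nbr[of e] d(1)
            dist_triangle[of "y' (left_cell e)" "y' (right_cell e)" "centre d (left_cell e)"]
            dist_triangle[of "centre d (left_cell e)" "y' (right_cell e)" "centre d (right_cell e)"]
          by (simp add: dist_commute)
        show ?thesis using compat[OF y'(1)[OF lS] y'(1)[OF rS] 2 1] lS rS by (simp add: f'_def)
      qed
      have "norm (edge_term d f' e z) \<le> \<epsilon> / d * norm (node d (edge_end e) - node d (snd e))"
        unfolding edge_term_def edge_path_def
      proof (rule contour_integral_bound_linepath)
        have "f' q holomorphic_on UNIV" if "q \<in> S" for q using hol y'(1) that by (simp add: f'_def)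
        then have "continuous_on (closed_segment (node d (snd e)) (node d (edge_end e))) (f' q)" if "q \<in> S" for q
          using that holomorphic_on_imp_continuous_on continuous_on_subset by blast
        then show "(\<lambda>w. (f' (left_cell e) w - f' (right_cell e) w) / (w - z)) contour_integrable_on
            linepath (node d (snd e)) (node d (edge_end e))"
          using lS rS off_grid_not_edge[OF z(2), of e]
          by (intro contour_integrable_continuous_linepath continuous_intros) (auto simp: edge_seg_def)
        show "0 \<le> \<epsilon> / d" using \<open>0 \<le> \<epsilon>\<close> d(1) by simp
        fix w assume "w \<in> closed_segment (node d (snd e)) (node d (edge_end e))"
        then have w: "w \<in> edge_seg d e" by (simp add: edge_seg_def)
        show "norm ((f' (left_cell e) w - f' (right_cell e) w) / (w - z)) \<le> \<epsilon> / d"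
          unfolding norm_divide using jump[OF w] dist[OF w] d(1)
          by (intro frac_le \<open>0 \<le> \<epsilon>\<close>) (auto simp: dist_norm)
      qed
      then show ?thesis using d(1) by (simp add: edge_length)
    qed
    \<comment> \<open>\<open>z\<close> is within \<open>2 * d\<close> of \<open>x\<close> and within
      \<open>d\<close> of the centre of its cell, which leaves \<open>3 * d < 4 * d\<close>.\<close>
    have "cell_of d z \<in> B"
    proof -
      have "dist z (centre d (cell_of d z)) \<le> d"
      proof (rule dist_centre_le[OF d(1)])
        have fl: "\<bar>t - (d * of_int \<lfloor>t / d\<rfloor> + d / 2)\<bar> \<le> d / 2" for t
        proof -
          have "d * of_int \<lfloor>t / d\<rfloor> \<le> d * (t / d)" "d * (t / d) \<le> d * (of_int \<lfloor>t / d\<rfloor> + 1)"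
            using d(1) by (intro mult_left_mono; linarith)+
          moreover have "d * (t / d) = t" using d(1) by simp
          ultimately show ?thesis unfolding distrib_left by linarith
        qed
        show "\<bar>Re z - Re (centre d (cell_of d z))\<bar> \<le> d / 2" "\<bar>Im z - Im (centre d (cell_of d z))\<bar> \<le> d / 2"
          using fl[of "Re z"] fl[of "Im z"] by (simp_all add: centre_def node_def cell_of_def)
      qed
      then show ?thesis
        using z(1) dist_triangle[of x "centre d (cell_of d z)" z] d(1) by (simp add: B_def)
    qed
    then have "2 * pi * \<i> * P x z = (\<Sum>e\<in>edges_of S. edge_term d f' e z)"
      using BS hol y'(1) by (subst sum_edge_terms[OF d(1) cardS(1) _ _ z(2)]) (auto simp: f'_def y'_def)
    \<comment> \<open>The remaining edges have both neighbours outside \<open>S\<close>, where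
      \<open>f'\<close> vanishes.\<close>
    also have "\<dots> = (\<Sum>e\<in>Out \<union> In. edge_term d f' e z)"
      by (intro sum.mono_neutral_right finE) (auto simp: Out_def In_def edge_term_def f'_def)
    also have "\<dots> = (\<Sum>e\<in>Out. edge_term d f' e z) + (\<Sum>e\<in>In. edge_term d f' e z)"
      by (intro sum.union_disjoint finOut finIn) (auto simp: Out_def In_def)
    also have "(\<Sum>e\<in>Out. edge_term d f' e z) = 2 * pi * \<i> * H z"
      by (simp add: H_def same)
    finally have "2 * pi * \<i> * (H z - P x z) = - (\<Sum>e\<in>In. edge_term d f' e z)"
      by (simp add: algebra_simps)
    then have "norm (2 * pi * \<i> * (H z - P x z)) = norm (\<Sum>e\<in>In. edge_term d f' e z)"
      by (simp only: norm_minus_cancel)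
    then have "2 * pi * norm (H z - P x z) = norm (\<Sum>e\<in>In. edge_term d f' e z)"
      by (simp add: norm_mult)
    also have "\<dots> \<le> real (card In) * \<epsilon>"
      using inner by (intro sum_norm_bound)
    also have "\<dots> \<le> (6 * ((2 * R + 19)\<^sup>2 / d\<^sup>2)) * \<epsilon>"
    proof (rule mult_right_mono[OF _ \<open>0 \<le> \<epsilon>\<close>])
      have "In \<subseteq> edges_of S" by (auto simp: In_def)
      then have "card In \<le> 6 * card S"
        using card_mono[OF finE] card_edges_of(1)[OF cardS(1)] order_trans by blast
      then have "real (card In) \<le> 6 * real (card S)" by linarith
      then show "real (card In) \<le> 6 * ((2 * R + 19)\<^sup>2 / d\<^sup>2)" using cardS(2) by linarith
    qed
    also have "\<dots> = M" by (simp add: M_def)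
    finally have "2 * pi * norm (H z - P x z) \<le> M" .
    moreover have "1 * norm (H z - P x z) \<le> 2 * pi * norm (H z - P x z)"
      using pi_ge_two by (intro mult_right_mono) auto
    ultimately show ?thesis by linarith
  qed
  show ?thesis
  proof (rule that[OF r(1)])
    show "poly_approx (\<Union>x\<in>L. cball x r) H"
      unfolding H_def
      by (intro poly_approx_mult poly_approx_const r(2) compact_minkowski_sum_cball L(1))
    show "H holomorphic_on ball x (2 * d)" if "x \<in> L" for x by (rule holH[OF that])
    fix x z assume x: "x \<in> L" and z: "z \<in> ball x (2 * d)"
    let ?T = "{w \<in> ball x (2 * d). off_grid d w}"
    have "norm (H z - P x z) \<le> M"
    \<comment> \<open>Both sides of the estimate survive the limit from points off the grid, since
      \<open>H\<close> and \<open>P x\<close> are continuous on the disc.\<close>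
    proof (rule tendsto_upperbound[where F = "at z within ?T" and f = "\<lambda>w. norm (H w - P x w)"])
      have "continuous_on (ball x (2 * d)) (\<lambda>w. norm (H w - P x w))"
        using holH[OF x] hol[OF x] holomorphic_on_subset
        by (intro continuous_intros holomorphic_on_imp_continuous_on) blast+
      then have "((\<lambda>w. norm (H w - P x w)) \<longlongrightarrow> norm (H z - P x z)) (at z within ball x (2 * d))"
        using z by (simp add: continuous_on_def)
      then show "((\<lambda>w. norm (H w - P x w)) \<longlongrightarrow> norm (H z - P x z)) (at z within ?T)"
        by (rule tendsto_within_subset) auto
      show "\<forall>\<^sub>F w in at z within ?T. norm (H w - P x w) \<le> M"
        using off[OF x] by (auto simp: eventually_at_filter)
      have "z islimpt ?T"
      proof (unfold islimpt_approachable, intro allI impI)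
        fix \<delta> :: real assume "\<delta> > 0"
        have "min \<delta> (2 * d - dist x z) / 2 > 0" using \<open>\<delta> > 0\<close> z by simp
        then obtain t where t: "0 < t" "t < min \<delta> (2 * d - dist x z) / 2"
          "off_grid d (z + of_real t * Complex 1 1)"
          using off_grid_dense by metis
        let ?w = "z + of_real t * Complex 1 1"
        have "norm (of_real t * Complex 1 1) \<le> 2 * t"
          using cmod_le[of "of_real t * Complex 1 1"] t(1) by simp
        then have dw: "dist ?w z \<le> 2 * t" by (simp add: dist_norm)
        have "?w \<noteq> z" using t(1) by (auto simp: complex_eq_iff)
        moreover have "dist x ?w < 2 * d"
          using dist_triangle[of x ?w z] dw t(2) by (simp add: dist_commute)
        ultimately show "\<exists>w\<in>?T. w \<noteq> z \<and> dist w z < \<delta>"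
          using dw t(2,3) by (intro bexI[of _ ?w]) auto
      qed
      then show "at z within ?T \<noteq> bot" using trivial_limit_within by blast
    qed
    then show "norm (H z - P x z) \<le> 6 * (2 * R + 19)\<^sup>2 / d\<^sup>2 * \<epsilon>" by (simp add: M_def)
  qed
qed

lemma higher_deriv_diff_bound:
  assumes hol: "f holomorphic_on ball x \<rho>" "g holomorphic_on ball x \<rho>" and "0 < r" "r < \<rho>"
    and le: "\<And>z. z \<in> cball x r \<Longrightarrow> norm (f z - g z) \<le> B"
  shows "norm ((deriv ^^ l) f x - (deriv ^^ l) g x) \<le> fact l * B / r ^ l"
proof -
  have "(\<lambda>z. f z - g z) holomorphic_on ball x \<rho>" by (intro holomorphic_intros hol)
  moreover have "cball x r \<subseteq> ball x \<rho>" "ball x r \<subseteq> ball x \<rho>" using \<open>r < \<rho>\<close> by auto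
  ultimately have "norm ((deriv ^^ l) (\<lambda>z. f z - g z) x) \<le> fact l * B / r ^ l"
    using \<open>0 < r\<close> le
    by (intro Cauchy_inequality)
      (auto intro: holomorphic_on_subset holomorphic_on_imp_continuous_on continuous_on_subset simp: dist_norm)
  then show ?thesis
    using higher_deriv_diff[OF hol open_ball, of x l] \<open>0 < r\<close> \<open>r < \<rho>\<close> by simp
qed

text \<open>The exponent \<open>m + 3\<close> is spent as follows: the number of edges costs
  \<open>d\<^sup>2\<close>, Cauchy's estimates on discs of radius \<open>d\<close> cost at most
  \<open>d ^ m\<close>, and one factor \<open>d\<close> remains to make the error small.\<close>

lemma glue_entire_family:
  fixes P :: "complex \<Rightarrow> complex \<Rightarrow> complex"
  assumes L: "compact L" "connected (- L)"
    and hol: "\<And>x. x \<in> L \<Longrightarrow> P x holomorphic_on UNIV"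
    and compat: "\<And>s x y z. 0 < s \<Longrightarrow> s \<le> s0 \<Longrightarrow> x \<in> L \<Longrightarrow> y \<in> L \<Longrightarrow> dist x y \<le> s \<Longrightarrow> dist z x \<le> s
        \<Longrightarrow> norm (P x z - P y z) \<le> A * s ^ (m + 3)"
    and "0 < s0" "0 \<le> A" "0 < e"
  obtains p where "\<And>x l. x \<in> L \<Longrightarrow> l \<le> m \<Longrightarrow> norm ((deriv ^^ l) (poly p) x - (deriv ^^ l) (P x) x) \<le> e"
proof -
  obtain R0 where R0: "\<And>x. x \<in> L \<Longrightarrow> norm x \<le> R0"
    using compact_imp_bounded[OF L(1)] by (auto simp: bounded_iff)
  define R where "R = max R0 1"
  have R: "1 \<le> R" "L \<subseteq> cball 0 R" using R0 by (auto simp: R_def le_max_iff_disj)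
  define M0 where "M0 = 6 * (2 * R + 19)\<^sup>2 * (A * 20 ^ (m + 3))"
  have M0: "M0 \<ge> 0" using \<open>0 \<le> A\<close> by (simp add: M0_def)
  \<comment> \<open>\<open>20 * d \<le> s0\<close> makes \<open>compat\<close> applicable; the last
    entry gives \<open>fact m * M0 * d \<le> e / 2\<close>.\<close>
  define d where "d = min (min 1 (s0 / 20)) (e / (2 * (fact m * M0 + 1)))"
  have pos: "fact m * M0 + 1 > 0" using M0 by (simp add: add_nonneg_pos)
  have d: "0 < d" "d \<le> 1" "20 * d \<le> s0" "d \<le> e / (2 * (fact m * M0 + 1))"
  proof -
    show "0 < d" unfolding d_def using \<open>0 < s0\<close> \<open>0 < e\<close> pos
      by (intro min_less_iff_conj[THEN iffD2] conjI divide_pos_pos mult_pos_pos) auto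
    have "d \<le> s0 / 20" unfolding d_def by (rule min.coboundedI1) (rule min.cobounded2)
    then show "20 * d \<le> s0" by linarith
  qed (simp_all add: d_def)
  obtain H r where r: "r > 0" and H: "poly_approx (\<Union>x\<in>L. cball x r) H"
    "\<And>x. x \<in> L \<Longrightarrow> H holomorphic_on ball x (2 * d)"
    "\<And>x z. x \<in> L \<Longrightarrow> z \<in> ball x (2 * d) \<Longrightarrow> norm (H z - P x z) \<le> 6 * (2 * R + 19)\<^sup>2 / d\<^sup>2 * (A * (20 * d) ^ (m + 3))"
  proof (rule glue_entire_family_at_scale[OF L R(2,1) hol _ _ d(1,2), where \<epsilon> = "A * (20 * d) ^ (m + 3)"])
    show "norm (P x z - P y z) \<le> A * (20 * d) ^ (m + 3)"
      if "x \<in> L" "y \<in> L" "dist x y \<le> 20 * d" "dist z x \<le> 20 * d" for x y z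
      using that d by (intro compat) auto
  qed (use \<open>0 \<le> A\<close> d in auto)
  have "6 * (2 * R + 19)\<^sup>2 / d\<^sup>2 * (A * (20 * d) ^ (m + 3)) = M0 * d ^ (m + 1)"
    using d(1) by (simp add: M0_def power_mult_distrib power_add power2_eq_square power3_eq_cube field_simps)
  note nearH = H(3)[unfolded this]
  \<comment> \<open>With \<open>d\<close> and \<open>H\<close> fixed, the polynomial may be as close
    to \<open>H\<close> as desired: \<open>\<rho>\<close> keeps the discs where \<open>H\<close> is
    approximated and holomorphic, and \<open>\<eta>\<close> leaves \<open>e / 2\<close> after
    Cauchy's estimates.\<close>
  define \<rho> where "\<rho> = min r d"
  have \<rho>: "0 < \<rho>" "\<rho> \<le> r" "\<rho> \<le> d" "\<rho> \<le> 1" using r d by (auto simp: \<rho>_def)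
  define \<eta> where "\<eta> = e / 2 * \<rho> ^ m / fact m"
  have "\<eta> > 0" using \<open>0 < e\<close> \<rho>(1) by (simp add: \<eta>_def)
  then obtain p where p: "\<And>z. z \<in> (\<Union>x\<in>L. cball x r) \<Longrightarrow> norm (H z - poly p z) \<le> \<eta>"
    using H(1) unfolding poly_approx_def by meson
  show ?thesis
  proof (rule that)
    fix x l assume x: "x \<in> L" and "l \<le> m"
    have fl: "(fact l :: real) \<le> fact m" using \<open>l \<le> m\<close> by (rule fact_mono)
    have holp: "poly p holomorphic_on T" for T by (intro holomorphic_intros)
    have holP: "P x holomorphic_on ball x (2 * d)" using hol[OF x] holomorphic_on_subset by blast
    have "norm ((deriv ^^ l) H x - (deriv ^^ l) (poly p) x) \<le> fact l * \<eta> / \<rho> ^ l"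
    proof (rule higher_deriv_diff_bound[OF H(2)[OF x] holp])
      fix z assume "z \<in> cball x \<rho>"
      then show "norm (H z - poly p z) \<le> \<eta>" using x \<rho>(2) by (intro p) force
    qed (use \<rho> d in auto)
    also have "\<dots> \<le> fact m * \<eta> / \<rho> ^ m"
      using fl \<open>\<eta> > 0\<close> \<rho> \<open>l \<le> m\<close> by (intro frac_le mult_right_mono power_decreasing) auto
    also have "\<dots> = e / 2" using \<rho>(1) by (simp add: \<eta>_def)
    finally have 1: "norm ((deriv ^^ l) H x - (deriv ^^ l) (poly p) x) \<le> e / 2" .
    have "norm ((deriv ^^ l) H x - (deriv ^^ l) (P x) x) \<le> fact l * (M0 * d ^ (m + 1)) / d ^ l"
      using d(1) by (intro higher_deriv_diff_bound[OF H(2)[OF x] holP] nearH[OF x]) auto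
    also have "\<dots> \<le> fact m * (M0 * d ^ (m + 1)) / d ^ m"
      using fl M0 d \<open>l \<le> m\<close> by (intro frac_le mult_right_mono power_decreasing) auto
    also have "\<dots> = (fact m * M0) * d" using d(1) by simp
    also have "\<dots> \<le> (fact m * M0 + 1) * (e / (2 * (fact m * M0 + 1)))"
      using d M0 by (intro mult_mono) auto
    also have "\<dots> = e / 2" using pos by (simp add: field_simps)
    finally have 2: "norm ((deriv ^^ l) H x - (deriv ^^ l) (P x) x) \<le> e / 2" .
    have "norm ((deriv ^^ l) (poly p) x - (deriv ^^ l) (P x) x)
        \<le> norm ((deriv ^^ l) H x - (deriv ^^ l) (poly p) x) + norm ((deriv ^^ l) H x - (deriv ^^ l) (P x) x)"
      by norm
    then show "norm ((deriv ^^ l) (poly p) x - (deriv ^^ l) (P x) x) \<le> e" using 1 2 by linarith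
  qed
qed

section \<open>The topology of \<open>A_infinity\<close>\<close>

text \<open>The choice made by \<open>SOME\<close> is harmless, since two continuous extensions
  agree on \<open>S\<close>, which is dense in its closure.\<close>

lemma continuous_extension_eq:
  fixes f h :: "complex \<Rightarrow> complex"
  assumes h: "is_continuous_extension S f h" and z: "z \<in> closure S"
  shows "continuous_extension S f z = h z"
proof -
  have k: "is_continuous_extension S f (continuous_extension S f)"
    using someI[of "is_continuous_extension S f", OF h] by (simp add: continuous_extension_def)
  have "continuous_on (closure S) (\<lambda>z. continuous_extension S f z - h z)"
    using h k unfolding is_continuous_extension_def by (intro continuous_on_diff) auto
  moreover have "continuous_extension S f w - h w = 0" if "w \<in> S" for w
    using h k that unfolding is_continuous_extension_def by simp
  ultimately have "continuous_extension S f z - h z = 0"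
    using z by (rule continuous_constant_on_closure)
  then show ?thesis by simp
qed

context
  fixes \<Omega> :: "complex set"
  assumes open_\<Omega>: "open \<Omega>"
begin

definition ext_deriv :: "nat \<Rightarrow> (complex \<Rightarrow> complex) \<Rightarrow> complex \<Rightarrow> complex" where
  "ext_deriv l g = continuous_extension \<Omega> ((deriv ^^ l) g)"

lemma ext_deriv_is_extension:
  assumes "g \<in> A_infinity \<Omega>"
  shows "is_continuous_extension \<Omega> ((deriv ^^ l) g) (ext_deriv l g)"
proof -
  have "\<exists>h. is_continuous_extension \<Omega> ((deriv ^^ l) g) h" using assms by (simp add: A_infinity_def)
  then show ?thesis unfolding ext_deriv_def continuous_extension_def by (rule someI_ex)
qed

lemma ext_deriv_continuous: "g \<in> A_infinity \<Omega> \<Longrightarrow> continuous_on (closure \<Omega>) (ext_deriv l g)"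
  and ext_deriv_eq_deriv: "g \<in> A_infinity \<Omega> \<Longrightarrow> z \<in> \<Omega> \<Longrightarrow> ext_deriv l g z = (deriv ^^ l) g z"
  using ext_deriv_is_extension unfolding is_continuous_extension_def by blast+

text \<open>This makes the sequence of extended derivatives of \<open>g\<close> a jet
  \<open>G\<close> as in the Taylor estimates.\<close>

lemma ext_deriv_has_field_derivative:
  assumes g: "g \<in> A_infinity \<Omega>" and z: "z \<in> \<Omega>"
  shows "(ext_deriv l g has_field_derivative ext_deriv (Suc l) g z) (at z)"
proof -
  have "g holomorphic_on \<Omega>" using g by (simp add: A_infinity_def)
  from has_field_derivative_higher_deriv[OF this open_\<Omega> z]
  have "((deriv ^^ l) g has_field_derivative ext_deriv (Suc l) g z) (at z)"
    using ext_deriv_eq_deriv[OF g z] by metis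
  then show ?thesis
    using has_field_derivative_transform_within_open[OF _ open_\<Omega> z] ext_deriv_eq_deriv[OF g] by metis
qed

lemma ext_deriv_diff:
  assumes h: "h \<in> A_infinity \<Omega>" and g: "g \<in> A_infinity \<Omega>" and z: "z \<in> closure \<Omega>"
  shows "ext_deriv l (\<lambda>z. h z - g z) z = ext_deriv l h z - ext_deriv l g z"
  unfolding ext_deriv_def[of l "\<lambda>z. h z - g z"]
proof (rule continuous_extension_eq[OF _ z])
  have "h holomorphic_on \<Omega>" "g holomorphic_on \<Omega>" using h g by (auto simp: A_infinity_def)
  then show "is_continuous_extension \<Omega> ((deriv ^^ l) (\<lambda>z. h z - g z)) (\<lambda>z. ext_deriv l h z - ext_deriv l g z)"
    unfolding is_continuous_extension_def using h g open_\<Omega>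
    by (auto intro!: continuous_intros ext_deriv_continuous simp: ext_deriv_eq_deriv higher_deriv_diff)
qed

text \<open>The derivatives of \<open>f\<close> on \<open>U\<close> are themselves the continuous
  extensions. This is used for polynomials and for \<open>1 / (z - a)\<close> with \<open>a\<close>
  outside \<open>closure \<Omega>\<close>.\<close>

lemma restrict_in_A_infinity:
  assumes f: "f holomorphic_on U" and U: "open U" "closure \<Omega> \<subseteq> U"
  shows "restrict f \<Omega> \<in> A_infinity \<Omega>"
    and "z \<in> closure \<Omega> \<Longrightarrow> ext_deriv l (restrict f \<Omega>) z = (deriv ^^ l) f z"
proof -
  have sub: "\<Omega> \<subseteq> U" using U(2) closure_subset by blast
  have f\<Omega>: "f holomorphic_on \<Omega>" using f sub by (rule holomorphic_on_subset)
  then have r\<Omega>: "restrict f \<Omega> holomorphic_on \<Omega>" by (rule holomorphic_transform) simp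
  have "(deriv ^^ l) f holomorphic_on U" for l using f U(1) by (rule holomorphic_higher_deriv)
  then have ext: "is_continuous_extension \<Omega> ((deriv ^^ l) (restrict f \<Omega>)) ((deriv ^^ l) f)" for l
    unfolding is_continuous_extension_def
    using U(2) holomorphic_on_imp_continuous_on continuous_on_subset
      higher_deriv_transform_within_open[OF f\<Omega> r\<Omega> open_\<Omega>]
    by (metis restrict_apply')
  then show "restrict f \<Omega> \<in> A_infinity \<Omega>" using r\<Omega> by (auto simp: A_infinity_def)
  show "ext_deriv l (restrict f \<Omega>) z = (deriv ^^ l) f z" if "z \<in> closure \<Omega>"
    unfolding ext_deriv_def using ext that by (rule continuous_extension_eq)
qed

lemma seminorm_diff_le:
  assumes "h \<in> A_infinity \<Omega>" "g \<in> A_infinity \<Omega>" "K \<subseteq> closure \<Omega>" "0 \<le> e"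
    and "\<And>l z. l \<le> m \<Longrightarrow> z \<in> K \<Longrightarrow> norm (ext_deriv l h z - ext_deriv l g z) \<le> e"
  shows "A_infinity_seminorm \<Omega> m K (\<lambda>z. h z - g z) \<le> e"
  unfolding A_infinity_seminorm_def ext_deriv_def[symmetric]
  by (rule cSup_least) (use assms in \<open>auto simp: ext_deriv_diff subset_iff\<close>)

text \<open>Compactness of \<open>K\<close> bounds the set of values, so that its \<open>Sup\<close>
  is an upper bound.\<close>

lemma seminorm_diff_ge:
  assumes hg: "h \<in> A_infinity \<Omega>" "g \<in> A_infinity \<Omega>" and K: "compact K" "K \<subseteq> closure \<Omega>"
    and lz: "l \<le> m" "z \<in> K"
  shows "norm (ext_deriv l h z - ext_deriv l g z) \<le> A_infinity_seminorm \<Omega> m K (\<lambda>z. h z - g z)"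
proof -
  define f where "f = (\<lambda>z. h z - g z)"
  have f: "ext_deriv l f z = ext_deriv l h z - ext_deriv l g z" if "z \<in> K" for l z
    using ext_deriv_diff[OF hg] that K(2) by (auto simp: f_def)
  have "bounded (ext_deriv l f ` K)" for l
  proof -
    have "bounded ((\<lambda>z. ext_deriv l h z - ext_deriv l g z) ` K)"
      using hg K by (intro compact_imp_bounded compact_continuous_image continuous_intros
          continuous_on_subset[OF ext_deriv_continuous])
    then show ?thesis using f by (simp cong: image_cong)
  qed
  then have "bounded (\<Union>l\<le>m. ext_deriv l f ` K)" by (intro bounded_UN) auto
  then obtain M where M: "\<And>l z. l \<le> m \<Longrightarrow> z \<in> K \<Longrightarrow> norm (ext_deriv l f z) \<le> M"
    by (auto simp: bounded_iff)
  have "norm (ext_deriv l f z) \<le> A_infinity_seminorm \<Omega> m K f"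
    unfolding A_infinity_seminorm_def ext_deriv_def[symmetric]
  proof (rule cSup_upper)
    show "bdd_above (insert 0 {cmod (ext_deriv l f z) |l z. l \<le> m \<and> z \<in> K})"
      using M by (auto simp: bdd_above_def intro!: exI[of _ "max 0 M"] simp: le_max_iff_disj)
  qed (use lz in blast)
  then show ?thesis using f[OF lz(2)] by (simp add: f_def)
qed

text \<open>The generating sets are seminorm balls with arbitrary centres. Induction over the
  generated topology shows that each open set contains a ball centred at \<open>g\<close> itself:
  intersections merge the data, and other centres are handled by the triangle inequality.\<close>

lemma A_infinity_neighbourhood:
  assumes "openin (A_infinity_topology \<Omega>) U" "g \<in> U"
  obtains m K \<delta> where "0 < \<delta>" "compact K" "K \<subseteq> closure \<Omega>"
    "\<And>h. h \<in> A_infinity \<Omega> \<Longrightarrow>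
       (\<And>l z. l \<le> m \<Longrightarrow> z \<in> K \<Longrightarrow> norm (ext_deriv l h z - ext_deriv l g z) \<le> \<delta>) \<Longrightarrow> h \<in> U"
proof -
  have "\<exists>m K \<delta>. 0 < \<delta> \<and> compact K \<and> K \<subseteq> closure \<Omega> \<and> (\<forall>h\<in>A_infinity \<Omega>.
      (\<forall>l\<le>m. \<forall>z\<in>K. norm (ext_deriv l h z - ext_deriv l g z) \<le> \<delta>) \<longrightarrow> h \<in> U)"
    using openin_topology_generated_by[OF assms(1)[unfolded A_infinity_topology_def]] assms(2)
  proof (induction U rule: generate_topology_on.induct)
    case (Int a b)
    then obtain m K \<delta> m' K' \<delta>' where "0 < \<delta>" "compact K" "K \<subseteq> closure \<Omega>"
      "\<forall>h\<in>A_infinity \<Omega>. (\<forall>l\<le>m. \<forall>z\<in>K. norm (ext_deriv l h z - ext_deriv l g z) \<le> \<delta>) \<longrightarrow> h \<in> a"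
      "0 < \<delta>'" "compact K'" "K' \<subseteq> closure \<Omega>"
      "\<forall>h\<in>A_infinity \<Omega>. (\<forall>l\<le>m'. \<forall>z\<in>K'. norm (ext_deriv l h z - ext_deriv l g z) \<le> \<delta>') \<longrightarrow> h \<in> b"
      by auto
    then show ?case
      by (intro exI[of _ "max m m'"] exI[of _ "K \<union> K'"] exI[of _ "min \<delta> \<delta>'"])
        (auto simp: compact_Un)
  next
    case (UN \<U>)
    then obtain k where "k \<in> \<U>" "g \<in> k" by blast
    with UN.IH[OF this] show ?case by (meson UnionI)
  next
    case (Basis s)
    then obtain g0 m K \<epsilon> where s: "s = {h \<in> A_infinity \<Omega>. A_infinity_seminorm \<Omega> m K (\<lambda>z. h z - g0 z) < \<epsilon>}"
      and g0: "g0 \<in> A_infinity \<Omega>" and K: "compact K" "K \<subseteq> closure \<Omega>" and "0 < \<epsilon>" by auto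
    define \<sigma> where "\<sigma> = A_infinity_seminorm \<Omega> m K (\<lambda>z. g z - g0 z)"
    have g: "g \<in> A_infinity \<Omega>" and "\<sigma> < \<epsilon>" using Basis s by (auto simp: \<sigma>_def)
    define \<delta> where "\<delta> = (\<epsilon> - \<sigma>) / 2"
    have "0 < \<delta>" "\<delta> + \<sigma> < \<epsilon>" using \<open>\<sigma> < \<epsilon>\<close> by (auto simp: \<delta>_def field_simps)
    have "h \<in> s" if h: "h \<in> A_infinity \<Omega>"
      and le: "\<forall>l\<le>m. \<forall>z\<in>K. norm (ext_deriv l h z - ext_deriv l g z) \<le> \<delta>" for h
    proof -
      \<comment> \<open>\<open>max 0\<close> meets the nonnegativity premise of
        \<open>seminorm_diff_le\<close> without a separate proof for
        \<open>\<sigma>\<close>.\<close>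
      have "norm (ext_deriv l h z - ext_deriv l g0 z) \<le> max 0 (\<delta> + \<sigma>)" if "l \<le> m" "z \<in> K" for l z
      proof -
        have "norm (ext_deriv l g z - ext_deriv l g0 z) \<le> \<sigma>"
          unfolding \<sigma>_def by (rule seminorm_diff_ge[OF g g0 K that])
        moreover have "norm (ext_deriv l h z - ext_deriv l g z) \<le> \<delta>" using le that by blast
        moreover have "norm (ext_deriv l h z - ext_deriv l g0 z)
            \<le> norm (ext_deriv l h z - ext_deriv l g z) + norm (ext_deriv l g z - ext_deriv l g0 z)"
          by norm
        ultimately show ?thesis by linarith
      qed
      then have "A_infinity_seminorm \<Omega> m K (\<lambda>z. h z - g0 z) \<le> max 0 (\<delta> + \<sigma>)"
        using h g0 K(2) by (intro seminorm_diff_le) auto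
      then show ?thesis using h \<open>\<delta> + \<sigma> < \<epsilon>\<close> \<open>0 < \<epsilon>\<close> by (simp add: s)
    qed
    then show ?case using \<open>0 < \<delta>\<close> K by blast
  qed auto
  then obtain m K \<delta> where *: "0 < \<delta>" "compact K" "K \<subseteq> closure \<Omega>"
    "\<forall>h\<in>A_infinity \<Omega>. (\<forall>l\<le>m. \<forall>z\<in>K. norm (ext_deriv l h z - ext_deriv l g z) \<le> \<delta>) \<longrightarrow> h \<in> U"
    by blast
  show ?thesis by (rule that[OF *(1-3), of m]) (simp add: *(4))
qed

end

section \<open>Density of the polynomials\<close>

text \<open>The extended derivatives of \<open>g\<close> form the jet, and its Taylor polynomials
  are glued with exponent \<open>m + 3\<close>, which controls \<open>m\<close> derivatives on
  \<open>K\<close>.\<close>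

lemma polynomials_dense_in_A_infinity:
  assumes "open \<Omega>" and int: "\<Omega> = interior (closure \<Omega>)" and reg: "strongly_regular (closure \<Omega>)"
    and unb: "\<And>C. C \<in> components (- closure \<Omega>) \<Longrightarrow> \<not> bounded C" and g: "g \<in> A_infinity \<Omega>"
  shows "g \<in> A_infinity_topology \<Omega> closure_of {restrict (poly p) \<Omega> | p. True}"
  unfolding in_closure_of topspace_A_infinity_topology
proof (intro conjI g allI impI)
  fix U assume "g \<in> U \<and> openin (A_infinity_topology \<Omega>) U"
  then have U: "openin (A_infinity_topology \<Omega>) U" "g \<in> U" by auto
  obtain m K \<delta> where K: "0 < \<delta>" "compact K" "K \<subseteq> closure \<Omega>"
    and nbhd: "\<And>h. h \<in> A_infinity \<Omega> \<Longrightarrow>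
       (\<And>l z. l \<le> m \<Longrightarrow> z \<in> K \<Longrightarrow> norm (ext_deriv \<Omega> l h z - ext_deriv \<Omega> l g z) \<le> \<delta>) \<Longrightarrow> h \<in> U"
    by (rule A_infinity_neighbourhood[OF \<open>open \<Omega>\<close> U]) blast
  obtain R where "\<forall>x\<in>K. norm x \<le> R"
    using compact_imp_bounded[OF K(2)] by (auto simp: bounded_iff)
  then have R: "K \<subseteq> cball 0 R" by auto
  \<comment> \<open>\<open>K\<close> is enlarged to a piece of \<open>closure \<Omega>\<close> whose
    complement is connected, as pole shifting requires.\<close>
  let ?L = "closure \<Omega> \<inter> cball 0 R" and ?G = "\<lambda>l. ext_deriv \<Omega> l g"
  have compL: "compact ?L" by (simp add: closed_Int_compact)
  have derG: "(?G l has_field_derivative ?G (Suc l) z) (at z)" if "z \<in> interior (closure \<Omega>)" for l z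
    using ext_deriv_has_field_derivative[OF \<open>open \<Omega>\<close> g] that int by blast
  obtain N s0 A where N: "m + 3 \<le> N" and s0: "0 < s0" and A: "0 \<le> A"
    and compat: "\<And>s x y z. 0 < s \<Longrightarrow> s \<le> s0 \<Longrightarrow> x \<in> ?L \<Longrightarrow> y \<in> ?L \<Longrightarrow> dist x y \<le> s \<Longrightarrow> dist z x \<le> s \<Longrightarrow>
       norm (taylor_sum ?G x 0 N z - taylor_sum ?G y 0 N z) \<le> A * s ^ (m + 3)"
    by (rule taylor_sums_compatible[where G = ?G and k = "m + 3" and R = R, OF reg ext_deriv_continuous[OF \<open>open \<Omega>\<close> g] derG]) blast+
  obtain p where p: "\<And>x l. x \<in> ?L \<Longrightarrow> l \<le> m \<Longrightarrow>
      norm ((deriv ^^ l) (poly p) x - (deriv ^^ l) (taylor_sum ?G x 0 N) x) \<le> \<delta>"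
    by (rule glue_entire_family[OF compL connected_complement_Int_cball[OF unb] holomorphic_on_taylor_sum
          compat s0 A K(1)]) blast+
  have holp: "poly p holomorphic_on UNIV" by (intro holomorphic_intros)
  have "restrict (poly p) \<Omega> \<in> U"
  proof (rule nbhd)
    show "restrict (poly p) \<Omega> \<in> A_infinity \<Omega>"
      using restrict_in_A_infinity(1)[OF \<open>open \<Omega>\<close> holp] by simp
    fix l z assume "l \<le> m" "z \<in> K"
    then have z: "z \<in> ?L" using K(3) R by auto
    \<comment> \<open>As \<open>l \<le> m < N\<close>, at least one term survives \<open>l\<close>
      differentiations, and at the centre the sum equals \<open>?G l z\<close>.\<close>
    obtain n where n: "N = Suc n + l" using N \<open>l \<le> m\<close> by (intro that[of "N - Suc l"]) simp
    have "(deriv ^^ l) (taylor_sum ?G z 0 N) z = ?G l z"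
      unfolding n higher_deriv_taylor_sum by simp
    moreover have "ext_deriv \<Omega> l (restrict (poly p) \<Omega>) z = (deriv ^^ l) (poly p) z"
      using restrict_in_A_infinity(2)[OF \<open>open \<Omega>\<close> holp] z by simp
    ultimately show "norm (ext_deriv \<Omega> l (restrict (poly p) \<Omega>) z - ?G l z) \<le> \<delta>"
      using p[OF z \<open>l \<le> m\<close>] by simp
  qed
  then show "\<exists>h. h \<in> {restrict (poly p) \<Omega> | p. True} \<and> h \<in> U" by blast
qed

text \<open>The function \<open>(z - a) * poly p z - 1\<close> has modulus 1 at \<open>a\<close>,
  but a good approximation of \<open>1 / (z - a)\<close> on the frontier of a bounded
  \<open>C\<close> would make it at most 1/2 there, against the maximum principle.\<close>

lemma no_bounded_component_if_dense:
  assumes "open \<Omega>"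
    and dense: "A_infinity_topology \<Omega> closure_of {restrict (poly p) \<Omega> | p. True} = A_infinity \<Omega>"
    and C: "C \<in> components (- closure \<Omega>)"
  shows "\<not> bounded C"
proof
  assume "bounded C"
  obtain a where a: "a \<in> C" using in_components_nonempty[OF C] by blast
  have a\<Omega>: "a \<notin> closure \<Omega>" using a in_components_subset[OF C] by blast
  define f where "f z = 1 / (z - a)" for z
  have holf: "f holomorphic_on - {a}" unfolding f_def by (intro holomorphic_intros) auto
  have U: "open (- {a})" "closure \<Omega> \<subseteq> - {a}" using a\<Omega> by auto
  \<comment> \<open>This frontier lies in \<open>closure \<Omega>\<close> and is compact because
    \<open>C\<close> is bounded, so it is admissible in a seminorm.\<close>
  define K where "K = frontier C"
  have "K \<subseteq> frontier (- closure \<Omega>)" unfolding K_def using C by (rule frontier_of_components_subset)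
  then have K: "K \<subseteq> closure \<Omega>" using frontier_subset_closed[OF closed_closure] by (auto simp: frontier_complement)
  have "compact K" unfolding K_def using \<open>bounded C\<close> by (rule compact_frontier_bounded)
  obtain M where M: "0 < M" "\<And>z. z \<in> K \<Longrightarrow> norm (z - a) \<le> M"
  proof -
    have "bounded ((\<lambda>z. z - a) ` K)"
      using \<open>compact K\<close> by (intro compact_imp_bounded compact_continuous_image continuous_intros)
    then show ?thesis using that by (auto simp: bounded_pos)
  qed
  let ?g = "restrict f \<Omega>"
  \<comment> \<open>The radius is such that multiplication by \<open>norm (z - a) \<le> M\<close>
    yields 1/2.\<close>
  let ?B = "{h \<in> A_infinity \<Omega>. A_infinity_seminorm \<Omega> 0 K (\<lambda>z. h z - ?g z) < 1 / (2 * M)}"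
  note g = restrict_in_A_infinity[OF \<open>open \<Omega>\<close> holf U]
  have openB: "openin (A_infinity_topology \<Omega>) ?B"
    unfolding A_infinity_topology_def
  proof (rule topology_generated_by_Basis, rule CollectI, intro exI conjI)
    show "?B = ?B" ..
    show "0 < 1 / (2 * M)" using M(1) by simp
  qed (fact g(1) K \<open>compact K\<close>)+
  have memB: "?g \<in> ?B"
  proof -
    have "A_infinity_seminorm \<Omega> 0 K (\<lambda>z. ?g z - ?g z) \<le> 0"
      by (rule seminorm_diff_le[OF \<open>open \<Omega>\<close> g(1) g(1) K]) auto
    then have "A_infinity_seminorm \<Omega> 0 K (\<lambda>z. ?g z - ?g z) < 1 / (2 * M)"
      by (rule le_less_trans) (use M(1) in simp)
    then show ?thesis using g(1) by blast
  qed
  have "?g \<in> A_infinity_topology \<Omega> closure_of {restrict (poly p) \<Omega> | p. True}"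
    unfolding dense by (rule g(1))
  then have "\<forall>T. ?g \<in> T \<and> openin (A_infinity_topology \<Omega>) T \<longrightarrow> (\<exists>h. h \<in> {restrict (poly p) \<Omega> | p. True} \<and> h \<in> T)"
    unfolding in_closure_of by (rule conjunct2)
  then have "\<exists>h. h \<in> {restrict (poly p) \<Omega> | p. True} \<and> h \<in> ?B"
    by (rule allE[of _ ?B]) (erule mp, rule conjI[OF memB openB])
  then obtain h where h: "h \<in> {restrict (poly p) \<Omega> | p. True}" "h \<in> ?B" by (elim exE conjE)
  from h(1) obtain p where "h = restrict (poly p) \<Omega>" by blast
  with h(2) have p: "restrict (poly p) \<Omega> \<in> ?B" by (simp only:)
  have holp: "poly p holomorphic_on UNIV" by (intro holomorphic_intros)
  note q = restrict_in_A_infinity[OF \<open>open \<Omega>\<close> holp open_UNIV subset_UNIV]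
  have close: "norm (poly p z - f z) \<le> 1 / (2 * M)" if "z \<in> K" for z
  proof -
    have "norm (ext_deriv \<Omega> 0 (restrict (poly p) \<Omega>) z - ext_deriv \<Omega> 0 ?g z)
        \<le> A_infinity_seminorm \<Omega> 0 K (\<lambda>z. restrict (poly p) \<Omega> z - ?g z)"
      by (rule seminorm_diff_ge[OF \<open>open \<Omega>\<close> q(1) g(1) \<open>compact K\<close> K _ that]) simp
    also have "\<dots> < 1 / (2 * M)" using p by blast
    also have "ext_deriv \<Omega> 0 (restrict (poly p) \<Omega>) z = poly p z" using q(2)[of z 0] that K by auto
    also have "ext_deriv \<Omega> 0 ?g z = f z" using g(2)[of z 0] that K by auto
    finally show ?thesis by simp
  qed
  have "norm ((a - a) * poly p a - 1) \<le> 1 / 2"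
  proof (rule maximum_modulus_frontier[OF _ _ \<open>bounded C\<close> _ a, of "\<lambda>z. (z - a) * poly p z - 1"])
    fix z assume "z \<in> frontier C"
    then have z: "z \<in> K" by (simp add: K_def)
    then have "z \<noteq> a" using K a\<Omega> by blast
    then have "(z - a) * poly p z - 1 = (z - a) * (poly p z - f z)"
      by (simp add: f_def algebra_simps)
    then have "norm ((z - a) * poly p z - 1) = norm (z - a) * norm (poly p z - f z)"
      by (simp add: norm_mult)
    also have "\<dots> \<le> M * (1 / (2 * M))" using M close z by (intro mult_mono) auto
    also have "\<dots> = 1 / 2" using M(1) by simp
    finally show "norm ((z - a) * poly p z - 1) \<le> 1 / 2" .
  qed (auto intro!: holomorphic_intros continuous_intros)
  then show False by simp
qed

theorem corollary14:
  fixes \<Omega> :: "complex set"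
  assumes "open \<Omega>"
    and "\<Omega> = interior (closure \<Omega>)"
    and "strongly_regular (closure \<Omega>)"
  shows "A_infinity_topology \<Omega> closure_of {restrict (poly p) \<Omega> | p. True} = A_infinity \<Omega>
     \<longleftrightarrow> \<not> (\<exists>C \<in> components (- closure \<Omega>). bounded C)"
proof
  assume "\<not> (\<exists>C \<in> components (- closure \<Omega>). bounded C)"
  then have "A_infinity \<Omega> \<subseteq> A_infinity_topology \<Omega> closure_of {restrict (poly p) \<Omega> | p. True}"
    using polynomials_dense_in_A_infinity[OF assms] by blast
  then show "A_infinity_topology \<Omega> closure_of {restrict (poly p) \<Omega> | p. True} = A_infinity \<Omega>"
    using closure_of_subset_topspace[of "A_infinity_topology \<Omega>"] topspace_A_infinity_topology by blast
qed (use no_bounded_component_if_dense[OF assms(1)] in blast)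

end
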